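(* Let $\mathbb{F}=\mathbb{R}$ or $\mathbb{F}=\mathbb{C}$, let $1\le p<\infty$, and let $L_p(0,\infty)$ be the space of (equivalence classes of) $\mathbb{F}$-valued $p$-integrable functions on $(0,\infty)$. Let $w\in\mathbb{F}$ with $|w|>1$ and let $a>0$. Then the weighted left translation $$(T_{w,a}x)(t):=w\,x(t+a),\quad x\in L_p(0,\infty),\ t\ge 0,$$ is a chaotic bounded linear operator on $L_p(0,\infty)$. Furthermore, if the underlying space is complex ($\mathbb{F}=\mathbb{C}$), then $$\sigma(T_{w,a})=\{\lambda\in\mathbb{C} : |\lambda|\le |w|\}$$ with $$\sigma_p(T_{w,a})=\{\lambda\in\mathbb{C} : |\lambda|<|w|\}\quad\text{and}\quad \sigma_c(T_{w,a})=\{\lambda\in\mathbb{C} : |\lambda|=|w|\}.$$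
   Context: Let $T$ be a linear operator in a (real or complex) Banach space $X$ with domain $D(T)$ (with $D(T)=X$ when $T$ is bounded on $X$); $T^0:=I$ is the identity operator, powers $T^n$ have their natural domains, and $C^\infty(T):=\bigcap_{n=0}^\infty D(T^n)$. A nonzero vector $x\in C^\infty(T)$ is hypercyclic for $T$ if its orbit $\{T^nx : n=0,1,2,\dots\}$ is dense in $X$; $T$ is hypercyclic if it has a hypercyclic vector. A vector $x$ is a periodic point of $T$ if there is $N\in\mathbb{N}=\{1,2,\dots\}$ with $x\in D(T^N)$ and $T^Nx=x$. $T$ is chaotic if it is hypercyclic and its set of periodic points is dense in $X$. For a closed linear operator $T$ in a complex Banach space $X$: the resolvent set $\rho(T)$ is the set of $\lambda\in\mathbb{C}$ such that $T-\lambda I$ has an inverse that is a bounded linear operator defined on all of $X$; the spectrum is $\sigma(T):=\mathbb{C}\setminus\rho(T)$; the point spectrum $\sigma_p(T)$ is the set of eigenvalues of $T$ (those $\lambda$ for which $T-\lambda I$ is not injective); the continuous spectrum $\sigma_c(T)$ is the set of $\lambda$ for which $T-\lambda I$ is injective, not surjective, and has range dense in $X$. *)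

theory Defs
  imports "HOL-Analysis.Analysis"
begin

section \<open>Measurable functions on the positive half-line modulo null sets\<close>

abbreviation halfline :: "real measure" where
  "halfline \<equiv> lebesgue_on {0<..}"

definition ae_equal ::
  "(real \<Rightarrow> 'a::{real_normed_field,second_countable_topology}) \<Rightarrow> (real \<Rightarrow> 'a) \<Rightarrow> bool" where
  "ae_equal f g \<longleftrightarrow> f \<in> borel_measurable halfline \<and> g \<in> borel_measurable halfline \<and>
     (AE t in halfline. f t = g t)"

lemma part_equivp_ae_equal: "part_equivp ae_equal"
proof (rule part_equivpI)
  show "\<exists>f :: real \<Rightarrow> 'a. ae_equal f f"
    by (rule exI[of _ "\<lambda>_. 0"]) (simp add: ae_equal_def)
  show "symp (ae_equal :: (real \<Rightarrow> 'a) \<Rightarrow> _)"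
    by (rule sympI) (auto simp: ae_equal_def elim: eventually_mono)
  show "transp (ae_equal :: (real \<Rightarrow> 'a) \<Rightarrow> _)"
    by (rule transpI) (auto simp: ae_equal_def elim: eventually_elim2)
qed

text \<open>
  The exponent \<open>p\<close> is a real number and so cannot be an argument of a type. The type below
  holds the classes of all measurable functions; each \<open>L\<^sub>p\<close> is a subset of it with its own norm,
  and the operator-theoretic notions are relative to such a subset.
\<close>

quotient_type (overloaded) 'a L0 =
  "real \<Rightarrow> 'a::{real_normed_field,second_countable_topology}" / partial: ae_equal
  by (rule part_equivp_ae_equal)

instantiation L0 :: ("{real_normed_field,second_countable_topology}") ab_group_add
begin

lift_definition zero_L0 :: "'a L0" is "\<lambda>_. 0"
  by (simp add: ae_equal_def)

lift_definition plus_L0 :: "'a L0 \<Rightarrow> 'a L0 \<Rightarrow> 'a L0" is "\<lambda>f g t. f t + g t"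
  unfolding ae_equal_def by (auto elim!: eventually_elim2)

lift_definition uminus_L0 :: "'a L0 \<Rightarrow> 'a L0" is "\<lambda>f t. - f t"
  unfolding ae_equal_def by (auto elim!: eventually_mono)

lift_definition minus_L0 :: "'a L0 \<Rightarrow> 'a L0 \<Rightarrow> 'a L0" is "\<lambda>f g t. f t - g t"
  unfolding ae_equal_def by (auto elim!: eventually_elim2)

instance
  by standard (transfer; auto simp: ae_equal_def algebra_simps)+

end

lift_definition scale_L0 ::
  "'a::{real_normed_field,second_countable_topology} \<Rightarrow> 'a L0 \<Rightarrow> 'a L0" is "\<lambda>c f t. c * f t"
  unfolding ae_equal_def by (auto elim!: eventually_mono)

lemma vector_space_scale_L0: "vector_space scale_L0"
  by unfold_locales (transfer; auto simp: ae_equal_def algebra_simps)+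

section \<open>The spaces \<open>L\<^sub>p(0,\<infinity>)\<close>\<close>

lift_definition p_integrable ::
  "real \<Rightarrow> 'a::{real_normed_field,second_countable_topology} L0 \<Rightarrow> bool" is
  "\<lambda>p f. integrable halfline (\<lambda>t. norm (f t) powr p)"
  unfolding ae_equal_def
  by (intro integrable_cong_AE) (auto elim!: eventually_mono)

definition Lp :: "real \<Rightarrow> 'a::{real_normed_field,second_countable_topology} L0 set" where
  "Lp p = {x. p_integrable p x}"

lift_definition Lp_norm ::
  "real \<Rightarrow> 'a::{real_normed_field,second_countable_topology} L0 \<Rightarrow> real" is
  "\<lambda>p f. (LINT t|halfline. norm (f t) powr p) powr (1 / p)"
  unfolding ae_equal_def
  by (intro arg_cong[where f = "\<lambda>u. u powr _"] integral_cong_AE) (auto elim!: eventually_mono)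

section \<open>Normed spaces given by a carrier\<close>

text \<open>
  Nonnegativity and homogeneity hold off the carrier too, as for \<open>Lp_norm\<close>, because
  \<open>Metric_space\<close> asks for a distance that is nonnegative and symmetric on the whole type.
\<close>

locale normed_space_on = vector_space scale
  for scale :: "'f::real_normed_field \<Rightarrow> 'v::ab_group_add \<Rightarrow> 'v" +
  fixes V :: "'v set" and nrm :: "'v \<Rightarrow> real"
  assumes subspace_carrier: "subspace V"
    and nrm_nonneg: "0 \<le> nrm x"
    and nrm_scale: "nrm (scale c x) = norm c * nrm x"
    and nrm_eq_0: "x \<in> V \<Longrightarrow> nrm x = 0 \<Longrightarrow> x = 0"
    and nrm_triangle: "x \<in> V \<Longrightarrow> y \<in> V \<Longrightarrow> nrm (x + y) \<le> nrm x + nrm y"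
begin

lemma Metric_space_carrier: "Metric_space V (\<lambda>x y. nrm (x - y))"
proof
  fix x y z
  show "0 \<le> nrm (x - y)" by (rule nrm_nonneg)
  show "nrm (x - y) = nrm (y - x)"
    using nrm_scale[of "-1" "x - y"] by simp
  show "nrm (x - y) = 0 \<longleftrightarrow> x = y" if "x \<in> V" "y \<in> V"
    using nrm_eq_0[of "x - y"] nrm_scale[of 0 0] subspace_diff[OF subspace_carrier that] by auto
  show "nrm (x - z) \<le> nrm (x - y) + nrm (y - z)" if "x \<in> V" "y \<in> V" "z \<in> V"
    using nrm_triangle[of "x - y" "y - z"] subspace_diff[OF subspace_carrier] that by simp
qed

end

lemma powr_convex_combination:
  fixes p u x y :: real
  assumes "1 \<le> p" "0 \<le> x" "0 \<le> y" "0 < u" "u < 1"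
  shows "(u * x + (1 - u) * y) powr p \<le> u * x powr p + (1 - u) * y powr p"
proof -
  have le: "v powr p \<le> v" if "0 < v" "v < 1" for v :: real
    using powr_mono'[of 1 p v] that assms(1) by simp
  consider "x = 0" | "y = 0" | "0 < x" "0 < y" using assms by linarith
  then show ?thesis
  proof cases
    case 1
    then show ?thesis
      using assms le[of "1 - u"] by (simp add: powr_mult mult_right_mono)
  next
    case 2
    then show ?thesis
      using assms le[of u] by (simp add: powr_mult mult_right_mono)
  next
    case 3
    then show ?thesis
      using convex_onD[OF powr_convex[OF assms(1)], of "1 - u" x y] assms by simp
  qed
qed

lemma powr_add_le:
  fixes p A B x y :: real
  assumes "1 \<le> p" "0 \<le> x" "0 \<le> y" "0 < A" "0 < B"
  shows "(x + y) powr p \<le>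
    (A + B) powr p * (A / (A + B) * (x powr p / A powr p) + B / (A + B) * (y powr p / B powr p))"
proof -
  define u where "u = A / (A + B)"
  have u: "0 < u" "u < 1" "1 - u = B / (A + B)" using assms by (auto simp: u_def field_simps)
  have "(A + B) * (u * (x / A)) = x" "(A + B) * ((1 - u) * (y / B)) = y"
    unfolding u(3) using assms by (simp_all add: u_def)
  then have "x + y = (A + B) * (u * (x / A) + (1 - u) * (y / B))"
    by (simp only: distrib_left)
  then have "(x + y) powr p = (A + B) powr p * (u * (x / A) + (1 - u) * (y / B)) powr p"
    using assms u by (simp add: powr_mult)
  also have "\<dots> \<le> (A + B) powr p * (u * (x / A) powr p + (1 - u) * (y / B) powr p)"
    using powr_convex_combination[of p "x / A" "y / B" u] assms u
    by (intro mult_left_mono) auto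
  finally show ?thesis
    using assms by (simp add: powr_divide u(3)) (simp add: u_def)
qed

lemma p_integrable_add:
  fixes x y :: "'a::{real_normed_field,second_countable_topology} L0"
  assumes p: "1 \<le> p" and "p_integrable p x" "p_integrable p y"
  shows "p_integrable p (x + y)"
  using assms(2,3)
proof (transfer fixing: p)
  fix f g :: "real \<Rightarrow> 'a"
  assume *: "ae_equal f f" "ae_equal g g"
    "integrable halfline (\<lambda>t. norm (f t) powr p)" "integrable halfline (\<lambda>t. norm (g t) powr p)"
  from *(1,2) have [measurable]: "f \<in> borel_measurable halfline" "g \<in> borel_measurable halfline"
    by (auto simp: ae_equal_def)
  show "integrable halfline (\<lambda>t. norm (f t + g t) powr p)"
  proof (rule Bochner_Integration.integrable_bound)
    show "integrable halfline
        (\<lambda>t. 2 powr p * (1/2 * (norm (f t) powr p) + 1/2 * (norm (g t) powr p)))"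
      using *(3,4) by simp
    have "norm (f t + g t) powr p
        \<le> 2 powr p * (1/2 * (norm (f t) powr p) + 1/2 * (norm (g t) powr p))" for t
      using powr_mono2[of p "norm (f t + g t)" "norm (f t) + norm (g t)"]
        norm_triangle_ineq[of "f t" "g t"] powr_add_le[of p "norm (f t)" "norm (g t)" 1 1] p
      by simp
    then show "AE t in halfline. norm (norm (f t + g t) powr p)
        \<le> norm (2 powr p * (1/2 * (norm (f t) powr p) + 1/2 * (norm (g t) powr p)))"
      by (intro AE_I2) (auto intro: order_trans)
  qed measurable
qed

lemma p_integrable_scale: "p_integrable p x \<Longrightarrow> p_integrable p (scale_L0 c x)"
  by transfer (simp add: norm_mult powr_mult)

lemma p_integrable_0: "p_integrable p 0"
  by transfer simp

lemma Lp_norm_nonneg: "0 \<le> Lp_norm p x"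
  by transfer simp

lemma Lp_norm_scale: "0 < p \<Longrightarrow> Lp_norm p (scale_L0 c x) = norm c * Lp_norm p x"
proof (transfer fixing: p)
  fix c :: 'a and f :: "real \<Rightarrow> 'a"
  assume "0 < p"
  then show "(LINT t|halfline. norm (c * f t) powr p) powr (1 / p)
      = norm c * (LINT t|halfline. norm (f t) powr p) powr (1 / p)"
    by (simp add: norm_mult powr_mult powr_powr)
qed

lemma Lp_norm_eq_0:
  "p_integrable p x \<Longrightarrow> Lp_norm p x = 0 \<Longrightarrow> x = 0"
proof (transfer fixing: p)
  fix f :: "real \<Rightarrow> 'a"
  assume *: "ae_equal f f" "integrable halfline (\<lambda>t. norm (f t) powr p)"
    "(LINT t|halfline. norm (f t) powr p) powr (1 / p) = 0"
  then have "AE t in halfline. norm (f t) powr p = 0"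
    using integral_nonneg_eq_0_iff_AE[OF *(2)] by simp
  then show "ae_equal f (\<lambda>_. 0)"
    using *(1) by (auto simp: ae_equal_def elim: eventually_mono)
qed

lemma Lp_norm_triangle_pos:
  fixes x y :: "'a::{real_normed_field,second_countable_topology} L0"
  assumes p: "1 \<le> p" and "p_integrable p x" "p_integrable p y"
    and "0 < Lp_norm p x" "0 < Lp_norm p y" and xy: "p_integrable p (x + y)"
  shows "Lp_norm p (x + y) \<le> Lp_norm p x + Lp_norm p y"
  using assms(2-)
proof (transfer fixing: p)
  fix f g :: "real \<Rightarrow> 'a"
  define A where "A = (LINT t|halfline. norm (f t) powr p) powr (1 / p)"
  define B where "B = (LINT t|halfline. norm (g t) powr p) powr (1 / p)"
  assume *: "ae_equal f f" "ae_equal g g"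
    "integrable halfline (\<lambda>t. norm (f t) powr p)" "integrable halfline (\<lambda>t. norm (g t) powr p)"
    "0 < (LINT t|halfline. norm (f t) powr p) powr (1 / p)"
    "0 < (LINT t|halfline. norm (g t) powr p) powr (1 / p)"
    "integrable halfline (\<lambda>t. norm (f t + g t) powr p)"
  then have AB: "0 < A" "0 < B" by (simp_all add: A_def B_def)
  have Ap: "A powr p = (LINT t|halfline. norm (f t) powr p)"
    and Bp: "B powr p = (LINT t|halfline. norm (g t) powr p)"
    using p by (simp_all add: A_def B_def powr_powr)
  let ?h = "\<lambda>t. (A + B) powr p *
    (A / (A + B) * (norm (f t) powr p / A powr p) + B / (A + B) * (norm (g t) powr p / B powr p))"
  have "norm (f t + g t) powr p \<le> ?h t" for t
    using powr_mono2[of p "norm (f t + g t)" "norm (f t) + norm (g t)"]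
      norm_triangle_ineq[of "f t" "g t"] powr_add_le[of p "norm (f t)" "norm (g t)" A B] p AB
    by simp
  then have "(LINT t|halfline. norm (f t + g t) powr p) \<le> (LINT t|halfline. ?h t)"
    using * by (intro integral_mono) auto
  also have "\<dots> = (A + B) powr p * (A / (A + B) * (A powr p / A powr p) + B / (A + B) * (B powr p / B powr p))"
    using *(3,4) by (simp add: Ap Bp)
  also have "\<dots> = (A + B) powr p"
    using AB by (simp add: add_divide_distrib[symmetric])
  finally have "(LINT t|halfline. norm (f t + g t) powr p) powr (1 / p) \<le> ((A + B) powr p) powr (1 / p)"
    using p by (intro powr_mono2) auto
  also have "\<dots> = A + B" using p AB by (simp add: powr_powr)
  finally show "(LINT t|halfline. norm (f t + g t) powr p) powr (1 / p)
      \<le> (LINT t|halfline. norm (f t) powr p) powr (1 / p)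
        + (LINT t|halfline. norm (g t) powr p) powr (1 / p)"
    by (simp add: A_def B_def)
qed

lemma normed_space_on_Lp:
  assumes p: "1 \<le> p"
  shows "normed_space_on scale_L0
    (Lp p :: 'a::{real_normed_field,second_countable_topology} L0 set) (Lp_norm p)"
proof -
  interpret vector_space "scale_L0 :: 'a \<Rightarrow> _" by (rule vector_space_scale_L0)
  show ?thesis
  proof
    show "subspace (Lp p :: 'a L0 set)"
      using p by (auto simp: subspace_def Lp_def p_integrable_0 p_integrable_add p_integrable_scale)
    show "x = 0" if "x \<in> Lp p" "Lp_norm p x = 0" for x :: "'a L0"
      using that Lp_norm_eq_0 by (auto simp: Lp_def)
    show "Lp_norm p (x + y) \<le> Lp_norm p x + Lp_norm p y"
      if "x \<in> Lp p" "y \<in> Lp p" for x y :: "'a L0"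
    proof (cases "Lp_norm p x = 0 \<or> Lp_norm p y = 0")
      case True
      then have "x = 0 \<or> y = 0"
        using that Lp_norm_eq_0 by (auto simp: Lp_def)
      then show ?thesis using Lp_norm_nonneg by auto
    next
      case False
      then show ?thesis
        using that p Lp_norm_nonneg[of p x] Lp_norm_nonneg[of p y]
        by (intro Lp_norm_triangle_pos p_integrable_add) (auto simp: Lp_def)
    qed
  qed (use p in \<open>auto simp: Lp_norm_nonneg Lp_norm_scale\<close>)
qed

section \<open>Linear operators in a normed space\<close>

text \<open>
  An operator in the space with carrier \<open>V\<close> and norm \<open>nrm\<close> is given by its domain \<open>D\<close> and a
  function \<open>T\<close> whose values outside \<open>D\<close> are irrelevant.
\<close>

definition linear_operator ::
  "('f::field \<Rightarrow> 'v::ab_group_add \<Rightarrow> 'v) \<Rightarrow> 'v set \<Rightarrow> 'v set \<Rightarrow> ('v \<Rightarrow> 'v) \<Rightarrow> bool" where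
  "linear_operator smul V D T \<longleftrightarrow>
     module.subspace smul D \<and> D \<subseteq> V \<and> T ` D \<subseteq> V \<and>
     (\<forall>x\<in>D. \<forall>y\<in>D. T (x + y) = T x + T y) \<and>
     (\<forall>c. \<forall>x\<in>D. T (smul c x) = smul c (T x))"

definition bounded_linear_operator ::
  "('f::field \<Rightarrow> 'v::ab_group_add \<Rightarrow> 'v) \<Rightarrow> 'v set \<Rightarrow> ('v \<Rightarrow> real) \<Rightarrow> ('v \<Rightarrow> 'v) \<Rightarrow> bool" where
  "bounded_linear_operator smul V nrm T \<longleftrightarrow>
     linear_operator smul V V T \<and> (\<exists>K. \<forall>x\<in>V. nrm (T x) \<le> K * nrm x)"

definition dense_in :: "'v::ab_group_add set \<Rightarrow> ('v \<Rightarrow> real) \<Rightarrow> 'v set \<Rightarrow> bool" where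
  "dense_in V nrm S \<longleftrightarrow>
     S \<subseteq> V \<and> Metric_space.mtopology V (\<lambda>x y. nrm (x - y)) closure_of S = V"

primrec power_domain :: "'v set \<Rightarrow> 'v set \<Rightarrow> ('v \<Rightarrow> 'v) \<Rightarrow> nat \<Rightarrow> 'v set" where
  "power_domain V D T 0 = V"
| "power_domain V D T (Suc n) = {x \<in> power_domain V D T n. (T ^^ n) x \<in> D}"

definition C_infinity :: "'v set \<Rightarrow> 'v set \<Rightarrow> ('v \<Rightarrow> 'v) \<Rightarrow> 'v set" where
  "C_infinity V D T = (\<Inter>n. power_domain V D T n)"

definition hypercyclic_vector ::
  "'v::ab_group_add set \<Rightarrow> ('v \<Rightarrow> real) \<Rightarrow> 'v set \<Rightarrow> ('v \<Rightarrow> 'v) \<Rightarrow> 'v \<Rightarrow> bool" where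
  "hypercyclic_vector V nrm D T x \<longleftrightarrow>
     x \<in> C_infinity V D T \<and> x \<noteq> 0 \<and> dense_in V nrm (range (\<lambda>n. (T ^^ n) x))"

definition hypercyclic ::
  "'v::ab_group_add set \<Rightarrow> ('v \<Rightarrow> real) \<Rightarrow> 'v set \<Rightarrow> ('v \<Rightarrow> 'v) \<Rightarrow> bool" where
  "hypercyclic V nrm D T \<longleftrightarrow> (\<exists>x. hypercyclic_vector V nrm D T x)"

definition periodic_points :: "'v set \<Rightarrow> 'v set \<Rightarrow> ('v \<Rightarrow> 'v) \<Rightarrow> 'v set" where
  "periodic_points V D T = {x. \<exists>N\<ge>1. x \<in> power_domain V D T N \<and> (T ^^ N) x = x}"

definition chaotic ::
  "'v::ab_group_add set \<Rightarrow> ('v \<Rightarrow> real) \<Rightarrow> 'v set \<Rightarrow> ('v \<Rightarrow> 'v) \<Rightarrow> bool" where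
  "chaotic V nrm D T \<longleftrightarrow>
     hypercyclic V nrm D T \<and> dense_in V nrm (periodic_points V D T)"

section \<open>Spectrum\<close>

definition resolvent_set ::
  "(complex \<Rightarrow> 'v::ab_group_add \<Rightarrow> 'v) \<Rightarrow> 'v set \<Rightarrow> ('v \<Rightarrow> real) \<Rightarrow> 'v set \<Rightarrow> ('v \<Rightarrow> 'v) \<Rightarrow> complex set"
  where
  "resolvent_set smul V nrm D T =
     {l. bij_betw (\<lambda>x. T x - smul l x) D V \<and>
         bounded_linear_operator smul V nrm (inv_into D (\<lambda>x. T x - smul l x))}"

definition spectrum ::
  "(complex \<Rightarrow> 'v::ab_group_add \<Rightarrow> 'v) \<Rightarrow> 'v set \<Rightarrow> ('v \<Rightarrow> real) \<Rightarrow> 'v set \<Rightarrow> ('v \<Rightarrow> 'v) \<Rightarrow> complex set"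
  where
  "spectrum smul V nrm D T = UNIV - resolvent_set smul V nrm D T"

definition point_spectrum ::
  "(complex \<Rightarrow> 'v::ab_group_add \<Rightarrow> 'v) \<Rightarrow> 'v set \<Rightarrow> ('v \<Rightarrow> 'v) \<Rightarrow> complex set" where
  "point_spectrum smul D T = {l. \<not> inj_on (\<lambda>x. T x - smul l x) D}"

definition continuous_spectrum ::
  "(complex \<Rightarrow> 'v::ab_group_add \<Rightarrow> 'v) \<Rightarrow> 'v set \<Rightarrow> ('v \<Rightarrow> real) \<Rightarrow> 'v set \<Rightarrow> ('v \<Rightarrow> 'v) \<Rightarrow> complex set"
  where
  "continuous_spectrum smul V nrm D T =
     {l. inj_on (\<lambda>x. T x - smul l x) D \<and> (\<lambda>x. T x - smul l x) ` D \<noteq> V \<and>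
         dense_in V nrm ((\<lambda>x. T x - smul l x) ` D)}"

section \<open>Weighted left translation\<close>

text \<open>
  The definition picks representatives; for \<open>a \<ge> 0\<close> the result does not depend on the choice
  (lemma \<open>weighted_translation_abs\<close>).
\<close>

definition weighted_translation ::
  "'a::{real_normed_field,second_countable_topology} \<Rightarrow> real \<Rightarrow> 'a L0 \<Rightarrow> 'a L0" where
  "weighted_translation w a x = abs_L0 (\<lambda>t. w * rep_L0 x (t + a))"

lemma shift_measurable_halfline:
  assumes "0 \<le> a"
  shows "(\<lambda>t. t + a) \<in> halfline \<rightarrow>\<^sub>M halfline"
proof -
  have "(\<lambda>t. a + (\<Sum>j\<in>Basis. (1 * (t \<bullet> j)) *\<^sub>R j)) \<in> lebesgue \<rightarrow>\<^sub>M lebesgue"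
    by (rule lebesgue_affine_measurable) auto
  then have "(\<lambda>t::real. t + a) \<in> lebesgue \<rightarrow>\<^sub>M lebesgue"
    by (simp add: add.commute)
  then show ?thesis
    using assms by (intro measurable_restrict_space3) auto
qed

lemma ae_equal_shift:
  assumes "ae_equal f g" "0 \<le> a"
  shows "ae_equal (\<lambda>t. w * f (t + a)) (\<lambda>t. w * g (t + a))"
proof -
  note [measurable] = shift_measurable_halfline[OF assms(2)]
  have [measurable]: "f \<in> borel_measurable halfline" "g \<in> borel_measurable halfline"
    using assms(1) by (auto simp: ae_equal_def)
  have "AE t in lebesgue. 0 < t \<longrightarrow> f t = g t"
    using assms(1) by (simp add: ae_equal_def AE_restrict_space_iff)
  then obtain N where N: "N \<in> null_sets lebesgue" "\<And>t. t \<notin> N \<Longrightarrow> 0 < t \<Longrightarrow> f t = g t"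
    by (auto elim!: AE_E3)
  have "AE t in lebesgue. t \<notin> (+) (- a) ` N"
    using negligible_translation[of N "- a"] N(1) by (intro AE_not_in) (simp add: negligible_iff_null_sets)
  then have "AE t in lebesgue. 0 < t \<longrightarrow> f (t + a) = g (t + a)"
  proof (eventually_elim, intro impI)
    fix t :: real
    assume t: "t \<notin> (+) (- a) ` N" "0 < t"
    then have "t + a \<notin> N" by (auto simp: image_iff)
    with N(2) t(2) assms(2) show "f (t + a) = g (t + a)" by auto
  qed
  then have "AE t in halfline. f (t + a) = g (t + a)"
    by (simp add: AE_restrict_space_iff)
  then show ?thesis
    by (auto simp: ae_equal_def elim!: eventually_mono)
qed

lemma weighted_translation_abs:
  assumes "f \<in> borel_measurable halfline" "0 \<le> a"
  shows "weighted_translation w a (abs_L0 f) = abs_L0 (\<lambda>t. w * f (t + a))"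
proof -
  have "ae_equal f f" using assms(1) by (simp add: ae_equal_def)
  then have "ae_equal (rep_L0 (abs_L0 f)) f"
    by (rule Quotient3_rep_abs[OF Quotient3_L0])
  then show ?thesis
    unfolding weighted_translation_def
    using ae_equal_shift assms(2) Quotient3_rel_abs[OF Quotient3_L0] by blast
qed

end

theory Submission
  imports Defs
begin

text \<open>
  The proof separates operator theory from measure theory. Write \<open>T\<close> for the weighted left
  translation and \<open>r = |w|\<close>. The right translation by \<open>a\<close> with weight \<open>w\<^sup>-\<^sup>1\<close>, filled up by
  zero on \<open>(0, a]\<close>, is a right inverse \<open>R\<close> of \<open>T\<close>; it contracts by the factor \<open>r\<close>, while \<open>T\<close>
  expands by at most \<open>r\<close>. A function vanishing beyond some point is annihilated by a power of \<open>T\<close>,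
  and such functions are dense. These facts, together with completeness, separability
  and a nonzero kernel, form the locale \<open>generalized_backward_shift\<close>, and they imply everything else.

  Chaos: if \<open>T\<^sup>n y = 0\<close>, then \<open>y + R\<^sup>n c\<close> is close to \<open>y\<close> for large \<open>n\<close> and is mapped to \<open>c\<close> by
  \<open>T\<^sup>n\<close>, so that the Baire category theorem provides a dense orbit (\<open>hypercyclic_T\<close>). The solution
  of \<open>x = y + R\<^sup>n x\<close> is a periodic point close to \<open>y\<close> (\<open>periodic_points_dense\<close>).

  Spectrum: for \<open>|l| < r\<close> a kernel vector \<open>x0\<close> extends to the eigenvector
  \<open>x0 + l R x0 + l\<^sup>2 R\<^sup>2 x0 + \<dots>\<close> (\<open>eigenvector\<close>); for \<open>|l| > r\<close> the Neumann series
  inverts \<open>T - l\<close>. On the circle \<open>|l| = r\<close>, density of the vectors annihilated by powers of \<open>T\<close> gives both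
  injectivity (\<open>inj_diff_scale\<close>) and dense range (\<open>dense_range\<close>). Surjectivity there would bound the
  partial sums of the Neumann series uniformly, by the Banach-Steinhaus theorem, which the
  eigenvectors with eigenvalues \<open>s l\<close>, \<open>s \<rightarrow> 1\<close>, \<open>s < 1\<close>, contradict (\<open>not_surj_diff_scale\<close>).

  What remains is about \<open>L\<^sub>p\<close>: its completeness (\<open>banach_space_on_Lp\<close>) and the density of a
  countable set of step functions with bounded support (\<open>steps_dense\<close>).
\<close>



section \<open>Linear operators on normed spaces with a carrier\<close>

context normed_space_on
begin

sublocale metric: Metric_space V "\<lambda>x y. nrm (x - y)"
  by (rule Metric_space_carrier)

lemmas carrier_closed [simp, intro] =
  subspace_0[OF subspace_carrier] subspace_add[OF subspace_carrier]
  subspace_diff[OF subspace_carrier] subspace_neg[OF subspace_carrier]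
  subspace_scale[OF subspace_carrier]

lemma nrm_0 [simp]: "nrm 0 = 0"
  using nrm_scale[of 0 0] by simp

lemma nrm_minus [simp]: "nrm (- x) = nrm x"
  using nrm_scale[of "-1" x] by simp

lemma nrm_minus_commute: "nrm (x - y) = nrm (y - x)"
  using nrm_minus[of "x - y"] by simp

lemma nrm_triangle_diff: "x \<in> V \<Longrightarrow> y \<in> V \<Longrightarrow> nrm (x - y) \<le> nrm x + nrm y"
  using nrm_triangle[of x "- y"] by simp

lemma nrm_diff_triangle:
  "x \<in> V \<Longrightarrow> y \<in> V \<Longrightarrow> z \<in> V \<Longrightarrow> nrm (x - z) \<le> nrm (x - y) + nrm (y - z)"
  using nrm_triangle[of "x - y" "y - z"] by simp

lemma dense_in_iff:
  "dense_in V nrm S \<longleftrightarrow> S \<subseteq> V \<and> (\<forall>x\<in>V. \<forall>e>0. \<exists>s\<in>S. nrm (x - s) < e)"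
proof (cases "S \<subseteq> V")
  case True
  have *: "(\<exists>y\<in>S. y \<in> metric.mball x e) \<longleftrightarrow> (\<exists>y\<in>S. nrm (x - y) < e)" if "x \<in> V" for x e
    by (intro bex_cong refl) (use True that in \<open>simp add: metric.in_mball subset_iff\<close>)
  have "metric.mtopology closure_of S = {x \<in> V. \<forall>e>0. \<exists>y\<in>S. nrm (x - y) < e}"
    unfolding metric.metric_closure_of using * by (intro Collect_cong conj_cong refl) simp
  then show ?thesis
    using True unfolding dense_in_def by (simp only:) (rule iffI; force)
qed (simp add: dense_in_def)

lemma closure_of_eq_carrier_iff:
  assumes "S \<subseteq> V"
  shows "metric.mtopology closure_of S = V \<longleftrightarrow> (\<forall>x\<in>V. \<forall>e>0. \<exists>s\<in>S. nrm (x - s) < e)"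
  using dense_in_iff[of S] assms by (simp add: dense_in_def)

lemma openin_carrier_iff:
  assumes "S \<subseteq> V"
  shows "openin metric.mtopology S \<longleftrightarrow> (\<forall>x\<in>S. \<exists>e>0. \<forall>y\<in>V. nrm (x - y) < e \<longrightarrow> y \<in> S)"
proof -
  have "metric.mball x e \<subseteq> S \<longleftrightarrow> (\<forall>y\<in>V. nrm (x - y) < e \<longrightarrow> y \<in> S)" if "x \<in> S" for x e
    using that assms by (auto simp: metric.mball_def)
  then show ?thesis
    using assms unfolding metric.openin_mtopology by (simp add: Ball_def)
qed

lemma linear_operatorD:
  assumes "linear_operator scale V V T"
  shows "x \<in> V \<Longrightarrow> T x \<in> V"
    and "x \<in> V \<Longrightarrow> y \<in> V \<Longrightarrow> T (x + y) = T x + T y"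
    and "x \<in> V \<Longrightarrow> T (scale c x) = scale c (T x)"
    and "x \<in> V \<Longrightarrow> y \<in> V \<Longrightarrow> T (x - y) = T x - T y"
    and "T 0 = 0"
proof -
  have *: "\<And>x. x \<in> V \<Longrightarrow> T x \<in> V" "\<And>x y. x \<in> V \<Longrightarrow> y \<in> V \<Longrightarrow> T (x + y) = T x + T y"
    "\<And>c x. x \<in> V \<Longrightarrow> T (scale c x) = scale c (T x)"
    using assms unfolding linear_operator_def by auto
  show "x \<in> V \<Longrightarrow> T x \<in> V" "x \<in> V \<Longrightarrow> y \<in> V \<Longrightarrow> T (x + y) = T x + T y"
    "x \<in> V \<Longrightarrow> T (scale c x) = scale c (T x)" by (fact *)+
  show "T 0 = 0" using *(3)[of 0 0] by simp
  show "x \<in> V \<Longrightarrow> y \<in> V \<Longrightarrow> T (x - y) = T x - T y"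
    using *(2)[of "x - y" y] by (simp add: algebra_simps)
qed

lemma linear_operatorI:
  assumes "\<And>x. x \<in> V \<Longrightarrow> T x \<in> V"
    and "\<And>x y. x \<in> V \<Longrightarrow> y \<in> V \<Longrightarrow> T (x + y) = T x + T y"
    and "\<And>c x. x \<in> V \<Longrightarrow> T (scale c x) = scale c (T x)"
  shows "linear_operator scale V V T"
  using assms subspace_carrier unfolding linear_operator_def by auto

lemma linear_operator_funpow:
  "linear_operator scale V V T \<Longrightarrow> linear_operator scale V V (T ^^ n)"
proof (induction n)
  case (Suc n)
  note T = linear_operatorD[OF Suc.prems] and Tn = linear_operatorD[OF Suc.IH[OF Suc.prems]]
  show ?case by (rule linear_operatorI) (simp_all add: T Tn)
qed (simp add: linear_operatorI)

lemma nrm_funpow_le: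
  assumes "linear_operator scale V V T" and "0 \<le> K"
    and "\<And>x. x \<in> V \<Longrightarrow> nrm (T x) \<le> K * nrm x" and "x \<in> V"
  shows "nrm ((T ^^ n) x) \<le> K ^ n * nrm x"
proof (induction n)
  case (Suc n)
  have "nrm ((T ^^ Suc n) x) \<le> K * nrm ((T ^^ n) x)"
    using assms(3)[OF linear_operatorD(1)[OF linear_operator_funpow[OF assms(1)] assms(4)], of n]
    by simp
  also have "\<dots> \<le> K * (K ^ n * nrm x)"
    using Suc assms(2) by (rule mult_left_mono)
  finally show ?case by (simp add: mult.assoc)
qed simp

lemma power_domain_everywhere:
  "linear_operator scale V V T \<Longrightarrow> power_domain V V T n = V"
  by (induction n) (auto intro: linear_operatorD(1)[OF linear_operator_funpow])

end

section \<open>Complete normed spaces with a carrier\<close>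

locale banach_space_on = normed_space_on +
  assumes complete: "Metric_space.mcomplete V (\<lambda>x y. nrm (x - y))"
begin

text \<open>
  Summing the Neumann series amounts to finding a fixed point of the contraction
  \<open>x \<mapsto> y + Q x\<close>. In this form it produces periodic points, eigenvectors and the resolvent.
\<close>

lemma neumann_solution:
  assumes Q: "linear_operator scale V V Q" and "q < 1"
    and bound: "\<And>x. x \<in> V \<Longrightarrow> nrm (Q x) \<le> q * nrm x" and y: "y \<in> V"
  obtains x where "x \<in> V" "x = y + Q x"
proof -
  note Q = linear_operatorD[OF Q]
  have "(\<lambda>x. y + Q x) \<in> V \<rightarrow> V" using y Q(1) by auto
  moreover have "nrm ((y + Q u) - (y + Q v)) \<le> q * nrm (u - v)" if "u \<in> V" "v \<in> V" for u v
    using that bound[of "u - v"] by (simp add: Q(4))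
  ultimately obtain x where "x \<in> V" "y + Q x = x"
    using metric.Banach_fixedpoint_thm[OF complete, of "\<lambda>x. y + Q x" q] \<open>q < 1\<close> y by blast
  then show thesis using that by metis
qed

text \<open>
  A form of the Baire category theorem: the carrier contains \<open>0\<close>, so a set that is dense in it
  is not empty.
\<close>

lemma baire_point:
  fixes U :: "'i \<Rightarrow> 'b set"
  assumes "countable I" and "\<And>i. i \<in> I \<Longrightarrow> U i \<subseteq> V"
    and op: "\<And>i x. i \<in> I \<Longrightarrow> x \<in> U i \<Longrightarrow> \<exists>e>0. \<forall>y\<in>V. nrm (x - y) < e \<longrightarrow> y \<in> U i"
    and dns: "\<And>i x e. i \<in> I \<Longrightarrow> x \<in> V \<Longrightarrow> 0 < e \<Longrightarrow> \<exists>y\<in>U i. nrm (x - y) < e"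
  obtains x where "x \<in> V" "\<And>i. i \<in> I \<Longrightarrow> x \<in> U i"
proof (cases "I = {}")
  case True
  then show thesis using that[of 0] by auto
next
  case False
  have "metric.mtopology closure_of (\<Inter>(U ` I)) = V"
  proof (intro metric.metric_Baire_category[OF complete])
    fix W assume "W \<in> U ` I"
    then obtain i where i: "i \<in> I" and W: "W = U i" by blast
    show "openin metric.mtopology W \<and> metric.mtopology closure_of W = V"
      unfolding W openin_carrier_iff[OF assms(2)[OF i]] closure_of_eq_carrier_iff[OF assms(2)[OF i]]
      using op[OF i] dns[OF i] by blast
  qed (use assms(1) in simp)
  moreover have "0 \<in> V" by simp
  ultimately have "\<Inter>(U ` I) \<noteq> {}" by (metis closure_of_empty empty_iff)
  then show thesis using that assms(2) False by blast
qed

text \<open>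
  Each set \<open>U k\<close> of points where some \<open>S n\<close> exceeds \<open>k\<close> is open. By Baire, if all of them were dense,
  there would be a point in all of them, contrary to pointwise boundedness. So some \<open>U k\<close> misses a ball,
  and scaling the bound on this ball gives a bound on the norms of the operators.
\<close>

theorem uniform_boundedness:
  fixes S :: "nat \<Rightarrow> 'b \<Rightarrow> 'b"
  assumes S: "\<And>n. linear_operator scale V V (S n)"
    and bounded: "\<And>n. \<exists>K. \<forall>x\<in>V. nrm (S n x) \<le> K * nrm x"
    and pointwise: "\<And>x. x \<in> V \<Longrightarrow> \<exists>M. \<forall>n. nrm (S n x) \<le> M"
  shows "\<exists>M. \<forall>n. \<forall>x\<in>V. nrm (S n x) \<le> M * nrm x"
proof -
  note lin = linear_operatorD[OF S]
  define U where "U k = {x \<in> V. \<exists>n. real k < nrm (S n x)}" for k :: nat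
  have U_open: "\<exists>e>0. \<forall>y\<in>V. nrm (x - y) < e \<longrightarrow> y \<in> U k" if x: "x \<in> U k" for k x
  proof -
    obtain n where n: "x \<in> V" "real k < nrm (S n x)" using x unfolding U_def by blast
    obtain K where K: "\<And>x. x \<in> V \<Longrightarrow> nrm (S n x) \<le> K * nrm x" using bounded by blast
    define e where "e = (nrm (S n x) - k) / (\<bar>K\<bar> + 1)"
    have "y \<in> U k" if y: "y \<in> V" "nrm (x - y) < e" for y
    proof -
      have "nrm (S n x) - nrm (S n y) \<le> nrm (S n (x - y))"
        using nrm_triangle[of "S n (x - y)" "S n y"] y n lin by (simp add: lin(4))
      also have "\<dots> \<le> K * nrm (x - y)" using K y n by auto
      also have "\<dots> \<le> (\<bar>K\<bar> + 1) * nrm (x - y)" by (intro mult_right_mono) (auto simp: nrm_nonneg)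
      also have "\<dots> < (\<bar>K\<bar> + 1) * e" using y(2) by (intro mult_strict_left_mono) auto
      also have "\<dots> = nrm (S n x) - k" by (simp add: e_def)
      finally show ?thesis using y by (auto simp: U_def)
    qed
    moreover have "e > 0" using n by (auto simp: e_def)
    ultimately show ?thesis by blast
  qed
  have "\<exists>k x e. x \<in> V \<and> 0 < e \<and> (\<forall>y\<in>V. nrm (x - y) < e \<longrightarrow> y \<notin> U k)"
  proof (rule ccontr)
    assume "\<not> ?thesis"
    then have dns: "\<exists>y\<in>U k. nrm (x - y) < e" if "x \<in> V" "0 < e" for k x e
      using that unfolding U_def by blast
    obtain x where x: "x \<in> V" "\<And>k. x \<in> U k"
    proof (rule baire_point[of UNIV U])
      show "U k \<subseteq> V" for k by (auto simp: U_def)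
    qed (use U_open dns in auto)
    obtain M where M: "\<And>n. nrm (S n x) \<le> M" using pointwise x(1) by blast
    obtain k :: nat where k: "M \<le> k" using real_arch_simple by blast
    obtain n where "real k < nrm (S n x)" using x(2)[of k] by (auto simp: U_def)
    then show False using M[of n] k by linarith
  qed
  then obtain k x e where x: "x \<in> V" "0 < e"
    and "\<forall>y\<in>V. nrm (x - y) < e \<longrightarrow> y \<notin> U k"
    by blast
  then have ball: "nrm (S n y) \<le> real k" if "y \<in> V" "nrm (x - y) < e" for y n
    using that unfolding U_def by (force simp: not_less)
  have "nrm (S n y) \<le> 4 * k / e * nrm y" if y: "y \<in> V" for n y
  proof (cases "y = 0")
    case True
    then show ?thesis by (simp add: lin(5))
  next
    case False
    then have pos: "0 < nrm y" using nrm_eq_0[OF y] nrm_nonneg[of y] by fastforce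
    define c where "c = e / (2 * nrm y)"
    have c: "0 < c" "c * nrm y = e / 2" using pos x by (auto simp: c_def)
    let ?u = "scale (of_real c) y"
    have "nrm ?u < e" using c x by (simp add: nrm_scale)
    then have "nrm (S n (x + ?u)) \<le> k" "nrm (S n x) \<le> k"
      using ball[of "x + ?u" n] ball[of x n] x y by auto
    moreover have "S n ?u = S n (x + ?u) - S n x" using x y by (simp add: lin(2))
    ultimately have "nrm (S n ?u) \<le> 2 * k"
      using nrm_triangle_diff[of "S n (x + ?u)" "S n x"] x y lin(1) by fastforce
    then have "c * nrm (S n y) \<le> 2 * k" using y c by (simp add: lin(3) nrm_scale)
    then have "nrm (S n y) \<le> 2 * k / c" using c by (simp add: field_simps)
    then show ?thesis using pos x by (simp add: c_def)
  qed
  then show ?thesis by blast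
qed

end


section \<open>Operators with a contracting right inverse\<close>

text \<open>
  The model is a backward shift multiplied by a weight of modulus \<open>r\<close>: the factor by which \<open>T\<close> may
  expand is also the factor by which its right inverse \<open>R\<close> contracts. A single set \<open>C\<close> witnesses both
  separability and the density of the vectors annihilated by powers of \<open>T\<close>.
\<close>

locale generalized_backward_shift = banach_space_on scale V nrm
  for scale :: "'f::real_normed_field \<Rightarrow> 'v::ab_group_add \<Rightarrow> 'v" and V nrm +
  fixes T R :: "'v \<Rightarrow> 'v" and r :: real and C :: "'v set" and x0 :: 'v
  assumes T_linear: "linear_operator scale V V T"
    and R_linear: "linear_operator scale V V R"
    and nrm_T: "x \<in> V \<Longrightarrow> nrm (T x) \<le> r * nrm x"
    and nrm_R: "x \<in> V \<Longrightarrow> nrm (R x) \<le> nrm x / r"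
    and T_R: "x \<in> V \<Longrightarrow> T (R x) = x"
    and r_gt_1: "1 < r"
    and countable_C: "countable C"
    and C_carrier: "C \<subseteq> V"
    and C_dense: "x \<in> V \<Longrightarrow> 0 < e \<Longrightarrow> \<exists>c\<in>C. nrm (x - c) < e"
    and C_annihilated: "c \<in> C \<Longrightarrow> \<exists>n. (T ^^ n) c = 0"
    and kernel: "x0 \<in> V" "T x0 = 0" "x0 \<noteq> 0"
begin

lemmas T = linear_operatorD[OF T_linear]
lemmas R = linear_operatorD[OF R_linear]
lemmas Tn = linear_operatorD[OF linear_operator_funpow[OF T_linear]]
lemmas Rn = linear_operatorD[OF linear_operator_funpow[OF R_linear]]

lemma bounded_linear: "bounded_linear_operator scale V nrm T"
  using T_linear nrm_T unfolding bounded_linear_operator_def by blast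

lemma nrm_Tn: "x \<in> V \<Longrightarrow> nrm ((T ^^ n) x) \<le> r ^ n * nrm x"
  using nrm_funpow_le[OF T_linear, of r] nrm_T r_gt_1 by simp

lemma nrm_Rn: "x \<in> V \<Longrightarrow> nrm ((R ^^ n) x) \<le> (1 / r) ^ n * nrm x"
  using nrm_funpow_le[OF R_linear, of "1 / r"] nrm_R r_gt_1 by simp

lemma Tn_Rn: "x \<in> V \<Longrightarrow> (T ^^ n) ((R ^^ n) x) = x"
proof (induction n)
  case (Suc n)
  then show ?case by (simp only: funpow_Suc_right[of n T] funpow.simps(2)[of n R] o_apply T_R Rn(1))
qed simp

lemma annihilated_mono: "(T ^^ n) c = 0 \<Longrightarrow> n \<le> m \<Longrightarrow> (T ^^ m) c = 0"
  using Tn(5)[of "m - n"] funpow_add[of "m - n" n T] by simp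

lemma inverse_power_small: "0 < e \<Longrightarrow> \<exists>N. \<forall>n\<ge>N. (1 / r) ^ n < e"
  using LIMSEQ_realpow_zero[of "1 / r"] r_gt_1
  by (auto dest!: order_tendstoD(2) simp: eventually_sequentially)

text \<open>
  For large \<open>n\<close>, adding \<open>R\<^sup>n c\<close> to a vector annihilated by \<open>T\<^sup>n\<close> perturbs it little, and \<open>T\<^sup>n\<close> sends
  the sum exactly to \<open>c\<close>. Hence the vectors whose orbit meets a given ball form a dense open set.
\<close>

lemma hypercyclic_T: "hypercyclic V nrm V T"
proof -
  define U where "U = (\<lambda>(c, m). {x \<in> V. \<exists>n. nrm ((T ^^ n) x - c) < 1 / real (Suc m)})"
  obtain x where x: "x \<in> V" "\<And>i. i \<in> C \<times> UNIV \<Longrightarrow> x \<in> U i"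
  proof (rule baire_point[of "C \<times> UNIV" U])
    show "countable (C \<times> (UNIV :: nat set))" using countable_C by simp
    show "U i \<subseteq> V" for i by (cases i) (auto simp: U_def)
  next
    fix i x assume "i \<in> C \<times> (UNIV :: nat set)" and x: "x \<in> U i"
    then obtain c m where i: "i = (c, m)" "c \<in> V" using C_carrier by auto
    obtain n where n: "x \<in> V" "nrm ((T ^^ n) x - c) < 1 / real (Suc m)"
      using x by (auto simp: U_def i)
    define e where "e = (1 / real (Suc m) - nrm ((T ^^ n) x - c)) / r ^ n"
    have rn: "0 < r ^ n" using r_gt_1 by simp
    have "y \<in> U i" if y: "y \<in> V" "nrm (x - y) < e" for y
    proof -
      have "nrm ((T ^^ n) y - (T ^^ n) x) \<le> r ^ n * nrm (x - y)"
        using nrm_Tn[of "y - x" n] y n by (simp add: Tn(4) nrm_minus_commute[of y])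
      also have "\<dots> < r ^ n * e" using y rn by simp
      also have "\<dots> = 1 / real (Suc m) - nrm ((T ^^ n) x - c)" using r_gt_1 by (simp add: e_def)
      finally have "nrm ((T ^^ n) y - c) < 1 / real (Suc m)"
        using nrm_diff_triangle[of "(T ^^ n) y" "(T ^^ n) x" c] y n i by (simp add: Tn(1))
      then show ?thesis using y by (auto simp: U_def i)
    qed
    moreover have "0 < e" using n rn by (simp add: e_def)
    ultimately show "\<exists>e>0. \<forall>y\<in>V. nrm (x - y) < e \<longrightarrow> y \<in> U i" by blast
  next
    fix i x and e :: real assume "i \<in> C \<times> (UNIV :: nat set)" and x: "x \<in> V" and e: "0 < e"
    then obtain c m where i: "i = (c, m)" "c \<in> V" using C_carrier by auto
    obtain y where y: "y \<in> C" "nrm (x - y) < e / 2" using C_dense[OF x, of "e / 2"] e by auto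
    have yV: "y \<in> V" using y C_carrier by blast
    obtain N where N: "(T ^^ N) y = 0" using C_annihilated y by blast
    obtain M where M: "\<And>n. n \<ge> M \<Longrightarrow> (1 / r) ^ n < e / 2 / (nrm c + 1)"
      using inverse_power_small[of "e / 2 / (nrm c + 1)"] e nrm_nonneg[of c] by auto
    define n where "n = max N M"
    let ?u = "y + (R ^^ n) c"
    have "(T ^^ n) y = 0" by (rule annihilated_mono[OF N]) (simp add: n_def)
    then have "(T ^^ n) ?u = c" using yV i by (simp add: Tn(2) Rn(1) Tn_Rn)
    then have "?u \<in> U i" using yV i by (auto simp: U_def Rn(1) intro!: exI[of _ n])
    moreover have "nrm (x - ?u) < e"
    proof -
      have "nrm ((R ^^ n) c) \<le> (1 / r) ^ n * nrm c" by (rule nrm_Rn[OF i(2)])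
      also have "\<dots> \<le> (1 / r) ^ n * (nrm c + 1)" using r_gt_1 by (intro mult_left_mono) auto
      also have "\<dots> < e / 2"
      proof -
        have "0 < nrm c + 1" using nrm_nonneg[of c] by simp
        moreover have "(1 / r) ^ n < e / 2 / (nrm c + 1)" by (rule M) (simp add: n_def)
        ultimately show ?thesis by (simp only: pos_less_divide_eq)
      qed
      finally show ?thesis
        using nrm_triangle_diff[of "x - y" "(R ^^ n) c"] x yV i y(2) by (simp add: Rn(1) algebra_simps)
    qed
    ultimately show "\<exists>y\<in>U i. nrm (x - y) < e" by blast
  qed (rule that)
  have dns: "dense_in V nrm (range (\<lambda>n. (T ^^ n) x))"
    unfolding dense_in_iff
  proof (intro conjI ballI allI impI)
    show "range (\<lambda>n. (T ^^ n) x) \<subseteq> V" using x Tn(1) by blast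
    fix y and e :: real assume y: "y \<in> V" and e: "0 < e"
    obtain c where c: "c \<in> C" "nrm (y - c) < e / 2" using C_dense[OF y, of "e / 2"] e by auto
    obtain m where m: "1 / real (Suc m) < e / 2" using nat_approx_posE[of "e / 2"] e by auto
    obtain n where n: "nrm ((T ^^ n) x - c) < 1 / real (Suc m)"
      using x(2)[of "(c, m)"] c by (auto simp: U_def)
    have "nrm (y - (T ^^ n) x) < e"
      using nrm_diff_triangle[of y c "(T ^^ n) x"] y c C_carrier x m n
      by (auto simp: Tn(1) nrm_minus_commute[of c])
    then show "\<exists>s\<in>range (\<lambda>n. (T ^^ n) x). nrm (y - s) < e" by blast
  qed
  have "x \<noteq> 0"
  proof
    assume "x = 0"
    moreover have "0 < nrm x0" using kernel nrm_eq_0[of x0] nrm_nonneg[of x0] by fastforce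
    ultimately show False
      using dns kernel(1) unfolding dense_in_iff by (force simp: Tn(5))
  qed
  moreover have "x \<in> C_infinity V V T"
    using x(1) by (simp add: C_infinity_def power_domain_everywhere[OF T_linear])
  ultimately show ?thesis
    using dns unfolding hypercyclic_def hypercyclic_vector_def by blast
qed

text \<open>
  If \<open>T\<^sup>N c = 0\<close>, then the solution of \<open>x = c + R\<^sup>N x\<close> satisfies \<open>T\<^sup>N x = x\<close>, and it is close
  to \<open>c\<close> for large \<open>N\<close>.
\<close>

lemma periodic_points_dense: "dense_in V nrm (periodic_points V V T)"
  unfolding dense_in_iff
proof (intro conjI ballI allI impI)
  show "periodic_points V V T \<subseteq> V"
    by (auto simp: periodic_points_def power_domain_everywhere[OF T_linear])
  fix y and e :: real assume y: "y \<in> V" and e: "0 < e"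
  obtain c where c: "c \<in> C" "nrm (y - c) < e / 2" using C_dense[OF y, of "e / 2"] e by auto
  have cV: "c \<in> V" using c C_carrier by blast
  obtain M where M: "(T ^^ M) c = 0" using C_annihilated c by blast
  \<comment> \<open>A contraction factor \<open>q \<le> 1 / 2\<close> gives \<open>nrm x \<le> 2 nrm c\<close>, and then \<open>q \<le> d\<close> gives \<open>nrm (x - c) \<le> e / 2\<close>;
    the summand \<open>1\<close> avoids division by zero.\<close>
  define d where "d = min (1 / 2) (e / (4 * (nrm c + 1)))"
  have d: "0 < d" "d \<le> 1 / 2" "d * (nrm c + 1) \<le> e / 4"
  proof -
    have pos: "0 < 4 * (nrm c + 1)" using nrm_nonneg[of c] by simp
    then show "0 < d" using e by (simp add: d_def)
    show "d \<le> 1 / 2" unfolding d_def by (rule min.cobounded1)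
    have "d \<le> e / (4 * (nrm c + 1))" by (simp add: d_def)
    then have "d * (4 * (nrm c + 1)) \<le> e" by (simp only: pos_le_divide_eq[OF pos])
    then show "d * (nrm c + 1) \<le> e / 4" by (simp add: algebra_simps)
  qed
  obtain L where L: "\<And>n. n \<ge> L \<Longrightarrow> (1 / r) ^ n < d" using inverse_power_small[OF d(1)] by auto
  define N where "N = max 1 (max M L)"
  define q where "q = (1 / r) ^ N"
  have q: "q < d" "0 < q" using L[of N] r_gt_1 by (auto simp: q_def N_def)
  obtain x where x: "x \<in> V" "x = c + (R ^^ N) x"
    using neumann_solution[OF linear_operator_funpow[OF R_linear, of N], of q c] nrm_Rn[of _ N] q d cV
    unfolding q_def by auto
  have TNc: "(T ^^ N) c = 0" by (rule annihilated_mono[OF M]) (simp add: N_def)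
  have "(T ^^ N) x = (T ^^ N) (c + (R ^^ N) x)" using x(2) by simp
  also have "\<dots> = x" using cV x(1) TNc by (simp add: Tn(2) Rn(1) Tn_Rn)
  finally have "x \<in> periodic_points V V T"
    using x(1) by (auto simp: periodic_points_def power_domain_everywhere[OF T_linear] N_def
        intro!: exI[of _ N])
  moreover have "nrm (y - x) < e"
  proof -
    have R: "nrm ((R ^^ N) x) \<le> q * nrm x" using nrm_Rn[OF x(1)] by (simp add: q_def)
    have "nrm x \<le> nrm c + nrm ((R ^^ N) x)"
      using nrm_triangle[of c "(R ^^ N) x"] x cV by (simp add: Rn(1))
    also have "\<dots> \<le> nrm c + 1 / 2 * nrm x"
      using R mult_right_mono[of q "1 / 2" "nrm x"] q d nrm_nonneg[of x] by linarith
    finally have "nrm x \<le> 2 * (nrm c + 1)" by simp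
    then have "q * nrm x \<le> d * (2 * (nrm c + 1))"
      using q nrm_nonneg[of x] by (intro mult_mono) auto
    also have "\<dots> \<le> e / 2" using d(3) by (simp add: algebra_simps)
    finally have "nrm ((R ^^ N) x) \<le> e / 2" using R by simp
    moreover have "c - x = - (R ^^ N) x" using x(2) by (metis add_diff_cancel_left' minus_diff_eq)
    ultimately have "nrm (c - x) \<le> e / 2" by simp
    then show ?thesis using nrm_diff_triangle[of y c x] y cV x(1) c(2) by simp
  qed
  ultimately show "\<exists>s\<in>periodic_points V V T. nrm (y - s) < e" by blast
qed

theorem chaotic_T: "chaotic V nrm V T"
  using hypercyclic_T periodic_points_dense by (simp add: chaotic_def)

subsection \<open>Solving \<open>T x - l x = y\<close>\<close>

text \<open>
  The vector \<open>v = x0 + l R x0 + l\<^sup>2 R\<^sup>2 x0 + \<dots>\<close>; it is nonzero because \<open>v = 0\<close> in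
  \<open>v = x0 + l R v\<close> would give \<open>x0 = 0\<close>.
\<close>

lemma eigenvector:
  assumes "norm l < r"
  obtains v where "v \<in> V" "v \<noteq> 0" "T v = scale l v"
proof -
  have "linear_operator scale V V (\<lambda>x. scale l (R x))"
    by (rule linear_operatorI) (simp_all add: R scale_right_distrib mult.commute)
  moreover have "nrm (scale l (R x)) \<le> norm l / r * nrm x" if "x \<in> V" for x
    using mult_left_mono[OF nrm_R[OF that], of "norm l"] by (simp add: nrm_scale)
  moreover have "norm l / r < 1" using assms r_gt_1 by simp
  ultimately obtain v where v: "v \<in> V" "v = x0 + scale l (R v)"
    using neumann_solution[of "\<lambda>x. scale l (R x)" "norm l / r" x0] kernel(1) by blast
  have "T v = T (x0 + scale l (R v))" using v(2) by simp
  also have "\<dots> = scale l v" using v(1) kernel by (simp add: T R T_R)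
  finally have "T v = scale l v" .
  moreover have "v \<noteq> 0" using v(2) kernel(3) R(5) by auto
  ultimately show thesis using that v(1) by blast
qed

lemma funpow_eigenvector: "v \<in> V \<Longrightarrow> T v = scale l v \<Longrightarrow> (T ^^ n) v = scale (l ^ n) v"
  by (induction n) (simp_all add: T mult.commute)

lemma image_diff_scale_subset: "(\<lambda>x. T x - scale l x) ` V \<subseteq> V"
  using T(1) by auto

lemma linear_diff_scale: "linear_operator scale V V (\<lambda>x. T x - scale l x)"
  by (rule linear_operatorI)
     (simp_all add: T scale_right_distrib scale_right_diff_distrib mult.commute)

text \<open>
  If \<open>T x = l x\<close> and \<open>c\<close> is annihilated by \<open>T\<^sup>n\<close>, then \<open>l\<^sup>n x = T\<^sup>n (x - c)\<close> has norm at most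
  \<open>r\<^sup>n nrm (x - c)\<close>. Since such \<open>c\<close> are dense, \<open>r \<le> norm l\<close> forces \<open>x = 0\<close>.
\<close>

lemma inj_diff_scale:
  assumes "r \<le> norm l"
  shows "inj_on (\<lambda>x. T x - scale l x) V"
proof (rule inj_onI)
  fix u v assume uv: "u \<in> V" "v \<in> V" "T u - scale l u = T v - scale l v"
  define x where "x = u - v"
  have x: "x \<in> V" "T x = scale l x"
    using uv by (auto simp: x_def T(4) scale_right_diff_distrib algebra_simps)
  have "nrm x \<le> e" if e: "0 < e" for e
  proof -
    obtain c where c: "c \<in> C" "nrm (x - c) < e" using C_dense[OF x(1) e] by blast
    have cV: "c \<in> V" using c C_carrier by blast
    obtain n where n: "(T ^^ n) c = 0" using C_annihilated c by blast
    have "r ^ n * nrm x \<le> norm l ^ n * nrm x"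
      using assms r_gt_1 nrm_nonneg[of x] by (intro mult_right_mono power_mono) auto
    also have "\<dots> = nrm ((T ^^ n) (x - c))"
      using x(1) cV n funpow_eigenvector[OF x] by (simp add: Tn(4) nrm_scale norm_power)
    also have "\<dots> \<le> r ^ n * nrm (x - c)" using x(1) cV by (intro nrm_Tn) auto
    finally show ?thesis using c(2) r_gt_1 by (simp add: mult_le_cancel_left_pos)
  qed
  then have "nrm x = 0" using nrm_nonneg[of x] by (metis antisym field_le_epsilon add_0)
  then show "u = v" using nrm_eq_0[OF x(1)] by (simp add: x_def)
qed

lemma surj_diff_scale:
  assumes "r < norm l"
  shows "(\<lambda>x. T x - scale l x) ` V = V"
proof (rule antisym[OF image_diff_scale_subset], rule subsetI)
  fix y assume y: "y \<in> V"
  have l: "l \<noteq> 0" using assms r_gt_1 by auto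
  have "linear_operator scale V V (\<lambda>x. scale (inverse l) (T x))"
    by (rule linear_operatorI) (simp_all add: T scale_right_distrib mult.commute)
  moreover have "nrm (scale (inverse l) (T x)) \<le> r / norm l * nrm x" if "x \<in> V" for x
    using mult_left_mono[OF nrm_T[OF that], of "inverse (norm l)"]
    by (simp add: nrm_scale norm_inverse divide_inverse mult_ac)
  moreover have "r / norm l < 1" using assms r_gt_1 by (simp add: divide_less_eq)
  ultimately obtain x where x: "x \<in> V" "x = scale (- inverse l) y + scale (inverse l) (T x)"
    using neumann_solution[of "\<lambda>x. scale (inverse l) (T x)" "r / norm l" "scale (- inverse l) y"] y by blast
  have "scale l x = scale l (scale (- inverse l) y + scale (inverse l) (T x))" using x(2) by simp
  also have "\<dots> = T x - y" using l by (simp add: scale_right_diff_distrib)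
  finally have "y = T x - scale l x" by simp
  then show "y \<in> (\<lambda>x. T x - scale l x) ` V" using x(1) by blast
qed

lemma nrm_diff_scale_ge:
  assumes "x \<in> V"
  shows "(norm l - r) * nrm x \<le> nrm (T x - scale l x)"
proof -
  have "norm l * nrm x \<le> nrm (T x) + nrm (T x - scale l x)"
    using nrm_triangle_diff[of "T x" "T x - scale l x"] assms T(1) by (simp add: nrm_scale)
  then show ?thesis using nrm_T[OF assms] by (simp add: left_diff_distrib)
qed

lemma inverse_bounded:
  assumes "r < norm l"
  shows "bounded_linear_operator scale V nrm (inv_into V (\<lambda>x. T x - scale l x))"
proof -
  let ?A = "\<lambda>x. T x - scale l x"
  let ?B = "inv_into V ?A"
  note A = linear_operatorD[OF linear_diff_scale[of l]]
  have inj: "inj_on ?A V" using inj_diff_scale assms by simp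
  have B: "?B y \<in> V" "?A (?B y) = y" if "y \<in> V" for y
    using that inv_into_into[of y ?A V] f_inv_into_f[of y ?A V] surj_diff_scale[OF assms] by auto
  have BI: "?B y = x" if "x \<in> V" "?A x = y" for x y
    using inv_into_f_f[OF inj that(1)] that(2) by simp
  have "linear_operator scale V V ?B"
    by (rule linear_operatorI) (use B A in \<open>auto intro!: BI\<close>)
  moreover have "nrm (?B y) \<le> 1 / (norm l - r) * nrm y" if "y \<in> V" for y
    using nrm_diff_scale_ge[OF B(1)[OF that], of l] B(2)[OF that] assms by (simp add: field_simps)
  ultimately show ?thesis unfolding bounded_linear_operator_def by blast
qed

text \<open>On the generalized kernel of \<open>T\<close> the Neumann series for \<open>T - l\<close> is a finite sum.\<close>

lemma annihilated_in_range:
  assumes "l \<noteq> 0" "y \<in> V" "(T ^^ n) y = 0"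
  shows "y \<in> (\<lambda>x. T x - scale l x) ` V"
  using assms(2,3)
proof (induction n arbitrary: y)
  case 0
  then show ?case using T(5) by (auto intro!: image_eqI[of _ _ 0])
next
  case (Suc n)
  then have "(T ^^ n) (T y) = 0" by (simp only: funpow_Suc_right o_apply)
  then obtain x where x: "x \<in> V" "T y = T x - scale l x" using Suc T(1) by blast
  have "y = T (scale (inverse l) (x - y)) - scale l (scale (inverse l) (x - y))"
    using x Suc.prems assms(1) by (simp add: T scale_right_diff_distrib)
  then show ?case using x(1) Suc.prems by blast
qed

lemma dense_range:
  assumes "l \<noteq> 0"
  shows "dense_in V nrm ((\<lambda>x. T x - scale l x) ` V)"
  unfolding dense_in_iff
proof (intro conjI ballI allI impI)
  show "(\<lambda>x. T x - scale l x) ` V \<subseteq> V" by (rule image_diff_scale_subset)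
  fix y and e :: real assume "y \<in> V" "0 < e"
  then obtain c where c: "c \<in> C" "nrm (y - c) < e" using C_dense by blast
  then have "c \<in> (\<lambda>x. T x - scale l x) ` V"
    using annihilated_in_range[OF assms, of c] C_annihilated C_carrier by blast
  with c show "\<exists>s\<in>(\<lambda>x. T x - scale l x) ` V. nrm (y - s) < e" by blast
qed

text \<open>
  The partial sums of the Neumann series for \<open>- (T - l)\<^sup>-\<^sup>1\<close> telescope on the range of \<open>T - l\<close>.
  If this range were everything, they would therefore be pointwise bounded for \<open>norm l = r\<close>,
  hence uniformly bounded. But on eigenvectors with eigenvalue \<open>s l\<close>, where \<open>s < 1\<close> is close
  to \<open>1\<close>, they act as factors of modulus close to \<open>1 / ((1 - s) r)\<close>.
\<close>

lemma not_surj_diff_scale: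
  assumes l: "norm l = r"
  shows "(\<lambda>x. T x - scale l x) ` V \<noteq> V"
proof
  assume surj: "(\<lambda>x. T x - scale l x) ` V = V"
  have l0: "l \<noteq> 0" using l r_gt_1 by auto
  define S where "S n y = (\<Sum>k<n. scale (inverse l ^ Suc k) ((T ^^ k) y))" for n y
  have S_V: "S n y \<in> V" if "y \<in> V" for n y
    unfolding S_def using that by (intro subspace_sum[OF subspace_carrier]) (simp add: Tn(1))
  have S_linear: "linear_operator scale V V (S n)" for n
    by (rule linear_operatorI)
       (simp_all add: S_V, simp_all add: S_def Tn scale_right_distrib sum.distrib scale_sum_right mult.commute)
  have S_telescope: "S n (T x - scale l x) = scale (inverse l ^ n) ((T ^^ n) x) - x"
    if x: "x \<in> V" for n x
  proof (induction n)
    case (Suc n)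
    have "(T ^^ n) (T x) = (T ^^ Suc n) x" by (simp only: funpow_Suc_right o_apply)
    then have "scale (inverse l ^ Suc n) ((T ^^ n) (T x - scale l x))
        = scale (inverse l ^ Suc n) ((T ^^ Suc n) x) - scale (inverse l ^ n) ((T ^^ n) x)"
      using x l0 by (simp add: Tn(3,4) T(1) scale_right_diff_distrib)
    moreover have "S (Suc n) (T x - scale l x)
        = S n (T x - scale l x) + scale (inverse l ^ Suc n) ((T ^^ n) (T x - scale l x))"
      by (simp add: S_def)
    ultimately show ?case using Suc.IH by simp
  qed (simp add: S_def)
  have "\<exists>K. \<forall>x\<in>V. nrm (S n x) \<le> K * nrm x" for n
  proof (induction n)
    case 0
    show ?case by (rule exI[of _ 0]) (simp add: S_def)
  next
    case (Suc n)
    then obtain K where K: "\<And>x. x \<in> V \<Longrightarrow> nrm (S n x) \<le> K * nrm x" by blast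
    have "nrm (S (Suc n) x) \<le> (K + 1) * nrm x" if x: "x \<in> V" for x
    proof -
      have "nrm (S (Suc n) x) \<le> nrm (S n x) + nrm (scale (inverse l ^ Suc n) ((T ^^ n) x))"
        using nrm_triangle[of "S n x" "scale (inverse l ^ Suc n) ((T ^^ n) x)"] x S_V
        by (simp add: S_def Tn(1))
      moreover have "nrm (scale (inverse l ^ Suc n) ((T ^^ n) x)) \<le> 1 * nrm x"
      proof -
        have "nrm (scale (inverse l ^ Suc n) ((T ^^ n) x)) = inverse r ^ Suc n * nrm ((T ^^ n) x)"
          by (simp add: nrm_scale norm_mult norm_power norm_inverse l)
        also have "\<dots> \<le> inverse r ^ Suc n * (r ^ n * nrm x)"
          using nrm_Tn[OF x] r_gt_1 by (intro mult_left_mono) auto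
        also have "\<dots> = inverse r * nrm x" using r_gt_1 by (simp add: field_simps)
        also have "\<dots> \<le> 1 * nrm x"
          using r_gt_1 nrm_nonneg[of x] by (intro mult_right_mono) (auto simp: field_simps)
        finally show ?thesis .
      qed
      ultimately show ?thesis using K[OF x] by (simp add: distrib_right)
    qed
    then show ?case by blast
  qed
  moreover have "\<exists>M. \<forall>n. nrm (S n y) \<le> M" if "y \<in> V" for y
  proof -
    obtain x where x: "x \<in> V" "y = T x - scale l x" using \<open>y \<in> V\<close> surj by blast
    have "nrm (S n y) \<le> nrm x + nrm x" for n
    proof -
      have "nrm (scale (inverse l ^ n) ((T ^^ n) x)) = inverse r ^ n * nrm ((T ^^ n) x)"
        by (simp add: nrm_scale norm_power norm_inverse l)
      also have "\<dots> \<le> inverse r ^ n * (r ^ n * nrm x)"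
        using nrm_Tn[OF x(1)] r_gt_1 by (intro mult_left_mono) auto
      also have "\<dots> = nrm x" using r_gt_1 by (simp add: field_simps)
      finally show ?thesis
        using nrm_triangle_diff[of "scale (inverse l ^ n) ((T ^^ n) x)" x] x
        by (simp add: S_telescope Tn(1))
    qed
    then show ?thesis by blast
  qed
  ultimately have "\<exists>M. \<forall>n. \<forall>x\<in>V. nrm (S n x) \<le> M * nrm x"
    by (intro uniform_boundedness S_linear)
  then obtain M where M: "\<And>n x. x \<in> V \<Longrightarrow> nrm (S n x) \<le> M * nrm x"
    by blast
  \<comment> \<open>With \<open>s = 1 - d\<close> the bound \<open>M\<close> would give \<open>1 - s\<^sup>n \<le> M r d < 1 / 2\<close> for every \<open>n\<close>.\<close>
  define d where "d = 1 / (2 * (\<bar>M\<bar> * r + 1))"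
  have d: "0 < d" "d < 1" "\<bar>M\<bar> * r * d < 1 / 2"
    using r_gt_1 by (auto simp: d_def field_simps add_pos_nonneg intro: add_strict_increasing)
  define s :: real where "s = 1 - d"
  have s: "0 < s" "s < 1" using d by (auto simp: s_def)
  let ?m = "of_real s * l"
  have "norm ?m < r" using s l r_gt_1 by (simp add: norm_mult)
  then obtain v where v: "v \<in> V" "v \<noteq> 0" "T v = scale ?m v" using eigenvector by blast
  have nv: "0 < nrm v" using v nrm_eq_0[of v] nrm_nonneg[of v] by fastforce
  obtain n where n: "s ^ n < 1 / 2" using real_arch_pow_inv[of "1 / 2" s] s by auto
  have "?m - l = - (of_real d * l)" by (simp add: s_def left_diff_distrib)
  then have "T v - scale l v = scale (- (of_real d * l)) v"
    by (metis v(3) scale_left_diff_distrib)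
  moreover have "S n (T v - scale l v) = scale (of_real (s ^ n - 1)) v"
  proof -
    have "inverse l ^ n * ?m ^ n = of_real (s ^ n)"
      using l0 by (simp add: power_mult_distrib power_inverse)
    then have "S n (T v - scale l v) = scale (of_real (s ^ n)) v - scale 1 v"
      using S_telescope[OF v(1), of n] funpow_eigenvector[OF v(1,3), of n] by simp
    then show ?thesis by (simp only: scale_left_diff_distrib of_real_diff of_real_1)
  qed
  ultimately have "nrm (scale (of_real (s ^ n - 1)) v) \<le> M * nrm (scale (- (of_real d * l)) v)"
    using M[of "T v - scale l v" n] v(1) T(1) by simp
  then have "\<bar>s ^ n - 1\<bar> * nrm v \<le> M * (d * r) * nrm v"
    using d by (simp add: nrm_scale norm_mult l del: of_real_diff of_real_power)
  then have "\<bar>s ^ n - 1\<bar> \<le> M * (d * r)" using nv by simp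
  also have "\<dots> \<le> \<bar>M\<bar> * r * d" using d r_gt_1 by (simp add: mult_ac mult_right_mono)
  finally show False using n d by simp
qed

subsection \<open>The spectrum\<close>

lemma bij_diff_scale_iff: "bij_betw (\<lambda>x. T x - scale l x) V V \<longleftrightarrow> r < norm l"
proof
  assume bij: "bij_betw (\<lambda>x. T x - scale l x) V V"
  have "\<not> norm l < r"
  proof
    assume "norm l < r"
    then obtain v where v: "v \<in> V" "v \<noteq> 0" "T v = scale l v" using eigenvector by blast
    then show False
      using bij_betw_imp_inj_on[OF bij] inj_onD[of "\<lambda>x. T x - scale l x" V v 0] T(5) by simp
  qed
  moreover have "norm l \<noteq> r" using bij_betw_imp_surj_on[OF bij] not_surj_diff_scale by blast
  ultimately show "r < norm l" by linarith
next
  assume "r < norm l"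
  then show "bij_betw (\<lambda>x. T x - scale l x) V V"
    unfolding bij_betw_def using inj_diff_scale[of l] surj_diff_scale[of l] by simp
qed

lemma inj_diff_scale_iff: "inj_on (\<lambda>x. T x - scale l x) V \<longleftrightarrow> r \<le> norm l"
proof
  assume inj: "inj_on (\<lambda>x. T x - scale l x) V"
  show "r \<le> norm l"
  proof (rule ccontr)
    assume "\<not> r \<le> norm l"
    then obtain v where v: "v \<in> V" "v \<noteq> 0" "T v = scale l v" using eigenvector[of l] by auto
    then show False using inj_onD[OF inj, of v 0] T(5) by simp
  qed
qed (rule inj_diff_scale)

end

locale complex_generalized_backward_shift =
  generalized_backward_shift scale V nrm T R r C x0
  for scale :: "complex \<Rightarrow> 'v::ab_group_add \<Rightarrow> 'v" and V nrm T R r C x0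
begin

theorem spectrum_eq: "spectrum scale V nrm V T = {l. norm l \<le> r}"
  unfolding spectrum_def resolvent_set_def
  using bij_diff_scale_iff inverse_bounded by (auto simp: not_less)

theorem point_spectrum_eq: "point_spectrum scale V T = {l. norm l < r}"
  unfolding point_spectrum_def by (simp add: inj_diff_scale_iff not_le)

theorem continuous_spectrum_eq: "continuous_spectrum scale V nrm V T = {l. norm l = r}"
proof -
  have "l \<noteq> 0" if "norm l = r" for l :: complex using that r_gt_1 by auto
  then show ?thesis
    unfolding continuous_spectrum_def inj_diff_scale_iff
    using surj_diff_scale not_surj_diff_scale dense_range by (auto simp: le_less)
qed

end

section \<open>Classes of functions on the half-line\<close>

lemma ae_equal_refl_iff [simp]: "ae_equal f f \<longleftrightarrow> f \<in> borel_measurable halfline"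
  by (simp add: ae_equal_def)

lemma abs_L0_eq_iff:
  assumes "f \<in> borel_measurable halfline" "g \<in> borel_measurable halfline"
  shows "abs_L0 f = abs_L0 g \<longleftrightarrow> (AE t in halfline. f t = g t)"
  using Quotient3_rel[OF Quotient3_L0, of f g] assms by (simp add: ae_equal_def)

lemma abs_L0_cong:
  assumes "f \<in> borel_measurable halfline" "g \<in> borel_measurable halfline"
    and "\<And>t. 0 < t \<Longrightarrow> f t = g t"
  shows "abs_L0 f = abs_L0 g"
  unfolding abs_L0_eq_iff[OF assms(1,2)] using assms(3) by (intro AE_I2) simp

lemma L0_cases:
  obtains f where "f \<in> borel_measurable halfline" "x = abs_L0 f"
proof
  show "rep_L0 x \<in> borel_measurable halfline"
    using Quotient3_rep_reflp[OF Quotient3_L0, of x] by simp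
  show "x = abs_L0 (rep_L0 x)" by (simp add: Quotient3_abs_rep[OF Quotient3_L0])
qed

lemma abs_L0_add_diff:
  assumes "f \<in> borel_measurable halfline" "g \<in> borel_measurable halfline"
  shows "abs_L0 f + abs_L0 g = abs_L0 (\<lambda>t. f t + g t)"
    and "abs_L0 f - abs_L0 g = abs_L0 (\<lambda>t. f t - g t)"
  using assms by (simp_all add: plus_L0.abs_eq minus_L0.abs_eq)

lemma scale_abs_L0:
  "f \<in> borel_measurable halfline \<Longrightarrow> scale_L0 c (abs_L0 f) = abs_L0 (\<lambda>t. c * f t)"
  by (simp add: scale_L0.abs_eq)

lemma abs_L0_in_Lp_iff:
  "f \<in> borel_measurable halfline \<Longrightarrow>
    abs_L0 f \<in> Lp p \<longleftrightarrow> integrable halfline (\<lambda>t. norm (f t) powr p)"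
  by (simp add: Lp_def p_integrable.abs_eq)

lemma Lp_norm_abs_L0:
  "f \<in> borel_measurable halfline \<Longrightarrow>
    Lp_norm p (abs_L0 f) = (LINT t|halfline. norm (f t) powr p) powr (1 / p)"
  by (simp add: Lp_norm.abs_eq)

lemma nn_integral_Lp_norm:
  assumes "0 < p" "f \<in> borel_measurable halfline" "abs_L0 f \<in> Lp p"
  shows "(\<integral>\<^sup>+t. ennreal (norm (f t) powr p) \<partial>halfline) = ennreal (Lp_norm p (abs_L0 f) powr p)"
proof -
  have "integrable halfline (\<lambda>t. norm (f t) powr p)" using assms abs_L0_in_Lp_iff by blast
  then have "(\<integral>\<^sup>+t. ennreal (norm (f t) powr p) \<partial>halfline) = ennreal (LINT t|halfline. norm (f t) powr p)"
    by (intro nn_integral_eq_integral) auto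
  then show ?thesis using assms(1) by (simp add: Lp_norm_abs_L0[OF assms(2)] powr_powr)
qed

lemma Lp_norm_leI:
  assumes p: "0 < p" and f[measurable]: "f \<in> borel_measurable halfline" and "0 \<le> B"
    and le: "(\<integral>\<^sup>+t. ennreal (norm (f t) powr p) \<partial>halfline) \<le> ennreal (B powr p)"
  shows "abs_L0 f \<in> Lp p" and "Lp_norm p (abs_L0 f) \<le> B"
proof -
  have "integrable halfline (\<lambda>t. norm (f t) powr p)"
    using le by (intro integrableI_nonneg) (auto simp: le_less_trans)
  then show Lp: "abs_L0 f \<in> Lp p" using abs_L0_in_Lp_iff f by blast
  have "Lp_norm p (abs_L0 f) powr p \<le> B powr p"
    using le nn_integral_Lp_norm[OF p f Lp] by simp
  then show "Lp_norm p (abs_L0 f) \<le> B"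
    using powr_less_mono2[of p B "Lp_norm p (abs_L0 f)"] p \<open>0 \<le> B\<close> by fastforce
qed

section \<open>Completeness\<close>

text \<open>Fatou's lemma bounds the limit before it is known to lie in \<open>L\<^sub>p\<close>.\<close>

lemma nn_integral_fatou_bound:
  fixes u :: "nat \<Rightarrow> 'b \<Rightarrow> 'a::{real_normed_vector,second_countable_topology}"
  assumes p: "0 < p" and [measurable]: "\<And>n. u n \<in> borel_measurable M" "v \<in> borel_measurable M"
    and lim: "AE t in M. (\<lambda>n. u n t) \<longlonglongrightarrow> v t"
    and bound: "eventually (\<lambda>n. (\<integral>\<^sup>+t. ennreal (norm (u n t) powr p) \<partial>M) \<le> B) sequentially"
  shows "(\<integral>\<^sup>+t. ennreal (norm (v t) powr p) \<partial>M) \<le> B"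
proof -
  have "AE t in M. ennreal (norm (v t) powr p) = liminf (\<lambda>n. ennreal (norm (u n t) powr p))"
    using lim
  proof eventually_elim
    case (elim t)
    have "(\<lambda>n. norm (u n t) powr p) \<longlonglongrightarrow> norm (v t) powr p"
      using p elim by (intro tendsto_powr' tendsto_norm tendsto_const) auto
    then show ?case by (intro lim_imp_Liminf[symmetric] tendsto_ennrealI) auto
  qed
  then have "(\<integral>\<^sup>+t. ennreal (norm (v t) powr p) \<partial>M) = (\<integral>\<^sup>+t. liminf (\<lambda>n. ennreal (norm (u n t) powr p)) \<partial>M)"
    by (rule nn_integral_cong_AE)
  also have "\<dots> \<le> liminf (\<lambda>n. \<integral>\<^sup>+t. ennreal (norm (u n t) powr p) \<partial>M)"
    by (rule nn_integral_liminf) measurable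
  also have "\<dots> \<le> B" using bound by (intro Liminf_le) auto
  finally show ?thesis .
qed

text \<open>
  If \<open>\<integral>|g (k+1) - g k|\<^sup>p \<le> 4\<^sup>-\<^sup>k\<^sup>p\<close>, then \<open>\<Sum>k. (2\<^sup>k |g (k+1) - g k|)\<^sup>p\<close> has a finite integral.
  Almost everywhere its terms tend to \<open>0\<close>, so \<open>|g (k+1) - g k| \<le> 2\<^sup>-\<^sup>k\<close> for large \<open>k\<close>.
\<close>

lemma AE_convergent_of_fast_Cauchy:
  fixes g :: "nat \<Rightarrow> 'b \<Rightarrow> 'a::{banach,second_countable_topology}"
  assumes p: "1 \<le> p" and [measurable]: "\<And>n. g n \<in> borel_measurable M"
    and fast: "\<And>k. (\<integral>\<^sup>+t. ennreal (norm (g (Suc k) t - g k t) powr p) \<partial>M) \<le> ennreal (((1/4) ^ k) powr p)"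
  shows "AE t in M. convergent (\<lambda>k. g k t)"
proof -
  let ?D = "\<lambda>k t. (2 ^ k * norm (g (Suc k) t - g k t)) powr p"
  have le: "(\<integral>\<^sup>+t. ennreal (?D k t) \<partial>M) \<le> ennreal ((1/2) ^ k)" for k
  proof -
    have "(\<integral>\<^sup>+t. ennreal (?D k t) \<partial>M)
        = (\<integral>\<^sup>+t. ennreal ((2 ^ k) powr p) * ennreal (norm (g (Suc k) t - g k t) powr p) \<partial>M)"
      by (simp add: powr_mult ennreal_mult)
    also have "\<dots> = ennreal ((2 ^ k) powr p) * (\<integral>\<^sup>+t. ennreal (norm (g (Suc k) t - g k t) powr p) \<partial>M)"
      by (rule nn_integral_cmult) measurable
    also have "\<dots> \<le> ennreal ((2 ^ k) powr p) * ennreal (((1/4) ^ k) powr p)"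
      by (intro mult_left_mono fast) auto
    also have "\<dots> = ennreal (((1/2) ^ k) powr p)"
      by (simp add: ennreal_mult[symmetric] powr_mult[symmetric] power_mult_distrib[symmetric])
    also have "\<dots> \<le> ennreal ((1/2) ^ k)"
      using powr_mono'[of 1 p "(1/2) ^ k"] p by (simp add: power_le_one)
    finally show ?thesis .
  qed
  have "(\<integral>\<^sup>+t. (\<Sum>k. ennreal (?D k t)) \<partial>M) = (\<Sum>k. \<integral>\<^sup>+t. ennreal (?D k t) \<partial>M)"
    by (rule nn_integral_suminf) measurable
  also have "\<dots> \<le> (\<Sum>k. ennreal ((1/2) ^ k))" using le by (intro suminf_le) auto
  also have "\<dots> < top" by (simp add: suminf_ennreal2)
  finally have "AE t in M. (\<Sum>k. ennreal (?D k t)) \<noteq> \<infinity>"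
    by (intro nn_integral_PInf_AE) auto
  then show ?thesis
  proof eventually_elim
    case (elim t)
    then have "summable (\<lambda>k. ?D k t)" by (intro summable_suminf_not_top) auto
    then have "eventually (\<lambda>k. ?D k t < 1) sequentially"
      by (intro order_tendstoD(2)[OF summable_LIMSEQ_zero]) auto
    then have "eventually (\<lambda>k. norm (g (Suc k) t - g k t) \<le> (1/2) ^ k) sequentially"
    proof eventually_elim
      case (elim k)
      then have "2 ^ k * norm (g (Suc k) t - g k t) \<le> 1"
        using powr_mono2[of p 1 "2 ^ k * norm (g (Suc k) t - g k t)"] p by (force simp: not_le)
      then show ?case by (simp add: field_simps power_one_over)
    qed
    then have "summable (\<lambda>k. g (Suc k) t - g k t)"
      by (rule summable_comparison_test_ev) simp
    then have "convergent (\<lambda>n. g n t - g 0 t)"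
      by (simp only: summable_iff_convergent sum_lessThan_telescope[of "\<lambda>n. g n t"])
    then have "convergent (\<lambda>n. (g n t - g 0 t) + g 0 t)"
      by (intro convergent_add convergent_const)
    then show ?case by simp
  qed
qed

lemma (in Metric_space) MCauchy_fast_subsequence:
  assumes "MCauchy X"
  obtains r where "strict_mono r" "\<And>k m n. r k \<le> m \<Longrightarrow> r k \<le> n \<Longrightarrow> d (X m) (X n) < (1/4) ^ k"
proof -
  have "\<exists>N. \<forall>m n. N \<le> m \<longrightarrow> N \<le> n \<longrightarrow> d (X m) (X n) < (1/4) ^ k" for k :: nat
    using assms unfolding MCauchy_def by (metis zero_less_power zero_less_divide_1_iff zero_less_numeral)
  then obtain N where N: "\<And>k m n. N k \<le> m \<Longrightarrow> N k \<le> n \<Longrightarrow> d (X m) (X n) < (1/4) ^ k" for k :: nat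
    by metis
  \<comment> \<open>Summing the thresholds makes them monotone, and adding \<open>k\<close> makes them strictly monotone.\<close>
  have "strict_mono (\<lambda>k. (\<Sum>j\<le>k. N j) + k)" by (simp add: strict_mono_Suc_iff)
  moreover have "N k \<le> (\<Sum>j\<le>k. N j) + k" for k by (simp add: sum.atMost_shift lessThan_Suc_atMost[symmetric])
  ultimately show thesis using N that order_trans by meson
qed

text \<open>
  The Riesz-Fischer theorem: a fast subsequence converges almost everywhere, and Fatou's lemma
  turns the Cauchy bounds into bounds on the distance to the pointwise limit.
\<close>

theorem banach_space_on_Lp:
  assumes p: "1 \<le> p"
  shows "banach_space_on scale_L0
    (Lp p :: 'a::{real_normed_field,euclidean_space} L0 set) (Lp_norm p)"
proof -
  interpret normed_space_on scale_L0 "Lp p :: 'a L0 set" "Lp_norm p"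
    by (rule normed_space_on_Lp[OF p])
  have p0: "0 < p" using p by simp
  have "metric.mcomplete"
    unfolding metric.mcomplete_def
  proof (intro allI impI)
    fix X assume X: "metric.MCauchy X"
    then have XV: "X n \<in> Lp p" for n by (auto simp: metric.MCauchy_def)
    have "\<exists>f. f \<in> borel_measurable halfline \<and> X n = abs_L0 f" for n by (metis L0_cases)
    then obtain f where f[measurable]: "\<And>n. f n \<in> borel_measurable halfline" and Xf: "\<And>n. X n = abs_L0 (f n)"
      by metis
    obtain r where r: "strict_mono r"
      and fast: "\<And>k m n. r k \<le> m \<Longrightarrow> r k \<le> n \<Longrightarrow> Lp_norm p (X m - X n) < (1/4) ^ k"
      using metric.MCauchy_fast_subsequence[OF X] by blast
    have nn: "(\<integral>\<^sup>+t. ennreal (norm (f m t - f n t) powr p) \<partial>halfline) \<le> ennreal (((1/4) ^ k) powr p)"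
      if "r k \<le> m" "r k \<le> n" for k m n
    proof -
      have "(\<integral>\<^sup>+t. ennreal (norm (f m t - f n t) powr p) \<partial>halfline) = ennreal (Lp_norm p (X m - X n) powr p)"
        using nn_integral_Lp_norm[OF p0, of "\<lambda>t. f m t - f n t"] carrier_closed(3)[OF XV XV, of m n]
        by (simp add: Xf abs_L0_add_diff(2))
      also have "\<dots> \<le> ennreal (((1/4) ^ k) powr p)"
        using fast[OF that] p by (intro ennreal_leI powr_mono2) (auto simp: Lp_norm_nonneg)
      finally show ?thesis .
    qed
    define h where "h t = lim (\<lambda>k. f (r k) t)" for t
    have [measurable]: "h \<in> borel_measurable halfline" unfolding h_def by measurable
    have "AE t in halfline. convergent (\<lambda>k. f (r k) t)"
      by (rule AE_convergent_of_fast_Cauchy[OF p])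
         (use nn strict_mono_less_eq[OF r] in auto)
    then have lim: "AE t in halfline. (\<lambda>k. f (r k) t) \<longlonglongrightarrow> h t"
      by eventually_elim (simp add: h_def convergent_LIMSEQ_iff)
    have bound: "(\<integral>\<^sup>+t. ennreal (norm (f (r k) t - h t) powr p) \<partial>halfline) \<le> ennreal (((1/4) ^ k) powr p)" for k
    proof (rule nn_integral_fatou_bound[OF p0, where u = "\<lambda>j t. f (r k) t - f (r j) t"])
      show "AE t in halfline. (\<lambda>j. f (r k) t - f (r j) t) \<longlonglongrightarrow> f (r k) t - h t"
        using lim by eventually_elim (intro tendsto_intros)
      show "\<forall>\<^sub>F j in sequentially.
          (\<integral>\<^sup>+t. ennreal (norm (f (r k) t - f (r j) t) powr p) \<partial>halfline) \<le> ennreal (((1/4) ^ k) powr p)"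
        using eventually_ge_at_top[of k]
        by eventually_elim (intro nn, simp_all add: strict_mono_less_eq[OF r])
    qed measurable
    have diff: "X (r k) - abs_L0 h \<in> Lp p" "Lp_norm p (X (r k) - abs_L0 h) \<le> (1/4) ^ k" for k
      using Lp_norm_leI[OF p0 _ _ bound, of k] by (simp_all add: Xf abs_L0_add_diff(2))
    have h: "abs_L0 h \<in> Lp p"
      using carrier_closed(3)[OF XV diff(1), of "r 0" 0] by simp
    have "limitin metric.mtopology (X \<circ> r) (abs_L0 h) sequentially"
      unfolding metric.limitin_metric
    proof (intro conjI allI impI)
      fix e :: real assume "0 < e"
      have "(\<lambda>k. (1/4) ^ k :: real) \<longlonglongrightarrow> 0" by (intro LIMSEQ_realpow_zero) auto
      then have "\<forall>\<^sub>F k in sequentially. (1/4) ^ k < e" using \<open>0 < e\<close> by (rule order_tendstoD)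
      then show "\<forall>\<^sub>F k in sequentially. (X \<circ> r) k \<in> Lp p \<and> Lp_norm p ((X \<circ> r) k - abs_L0 h) < e"
        by eventually_elim (use XV le_less_trans[OF diff(2)] in simp)
    qed (rule h)
    then show "\<exists>x. limitin metric.mtopology X x sequentially"
      using metric.MCauchy_convergent_subsequence[OF X r] by blast
  qed
  then show ?thesis by unfold_locales
qed

section \<open>Separability\<close>

text \<open>
  Since \<open>|u n| \<le> G\<close> passes to the limit, \<open>|f - u n|\<^sup>p\<close> is dominated by the integrable function
  \<open>(2 G)\<^sup>p\<close>.
\<close>

lemma Lp_dominated_convergence:
  fixes f :: "real \<Rightarrow> 'a::{real_normed_field,second_countable_topology}"
  assumes p: "0 < p"
    and [measurable]: "\<And>n. u n \<in> borel_measurable halfline" "f \<in> borel_measurable halfline"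
    and lim: "AE t in halfline. (\<lambda>n. u n t) \<longlonglongrightarrow> f t"
    and bound: "\<And>n t. 0 < t \<Longrightarrow> norm (u n t) \<le> G t"
    and G: "integrable halfline (\<lambda>t. G t powr p)"
  shows "abs_L0 (u n) \<in> Lp p" and "abs_L0 f \<in> Lp p"
    and "(\<lambda>n. Lp_norm p (abs_L0 f - abs_L0 (u n))) \<longlonglongrightarrow> 0"
proof -
  have powr_le: "norm (u n t) powr p \<le> G t powr p" if "0 < t" for n t
    using bound[OF that] p by (intro powr_mono2) auto
  have "integrable halfline (\<lambda>t. norm (u n t) powr p)" for n
    by (rule Bochner_Integration.integrable_bound[OF G]) (auto intro!: AE_I2 powr_le)
  then show "abs_L0 (u n) \<in> Lp p" for n by (simp add: abs_L0_in_Lp_iff)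
  have f_le: "AE t in halfline. 0 < t \<longrightarrow> norm (f t) \<le> G t"
    using lim
  proof eventually_elim
    case (elim t)
    show ?case
    proof
      assume "0 < t"
      then show "norm (f t) \<le> G t"
        using Lim_bounded[OF tendsto_norm[OF elim], of 0 "G t"] bound by blast
    qed
  qed
  have "AE t in halfline. norm (norm (f t) powr p) \<le> norm (G t powr p)"
    using f_le AE_space by eventually_elim (use p in \<open>auto intro!: powr_mono2\<close>)
  then have "integrable halfline (\<lambda>t. norm (f t) powr p)"
    by (intro Bochner_Integration.integrable_bound[OF G]) auto
  then show "abs_L0 f \<in> Lp p" by (simp add: abs_L0_in_Lp_iff)
  have "(\<lambda>n. LINT t|halfline. norm (f t - u n t) powr p) \<longlonglongrightarrow> (LINT t|halfline. 0)"
  proof (rule integral_dominated_convergence)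
    show "integrable halfline (\<lambda>t. 2 powr p * G t powr p)" using G by simp
    show "AE t in halfline. (\<lambda>n. norm (f t - u n t) powr p) \<longlonglongrightarrow> 0"
      using lim
    proof eventually_elim
      case (elim t)
      then have "(\<lambda>n. norm (f t - u n t)) \<longlonglongrightarrow> norm (f t - f t)"
        by (intro tendsto_intros)
      then show ?case using p by (auto intro: tendsto_zero_powrI)
    qed
    show "AE t in halfline. norm (norm (f t - u n t) powr p) \<le> 2 powr p * G t powr p" for n
      using f_le AE_space
    proof eventually_elim
      case (elim t)
      then have "0 < t" by simp
      then have "norm (f t - u n t) \<le> 2 * G t"
        using elim bound[of t n] norm_triangle_ineq4[of "f t" "u n t"] by simp
      moreover have "0 \<le> G t" using bound[OF \<open>0 < t\<close>] norm_ge_zero order_trans by blast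
      ultimately show ?case
        using p powr_mono2[of p "norm (f t - u n t)" "2 * G t"] by (simp add: powr_mult)
    qed
  qed auto
  then have "(\<lambda>n. (LINT t|halfline. norm (f t - u n t) powr p) powr (1 / p)) \<longlonglongrightarrow> 0"
    using p by (auto intro: tendsto_zero_powrI)
  then show "(\<lambda>n. Lp_norm p (abs_L0 f - abs_L0 (u n))) \<longlonglongrightarrow> 0"
    by (simp add: abs_L0_add_diff(2) Lp_norm_abs_L0)
qed

lemma borel_measurable_halfline: "f \<in> borel_measurable borel \<Longrightarrow> f \<in> borel_measurable halfline"
  by (intro measurable_restrict_space1 measurable_completion) simp

lemma integrable_halfline_cutoff:
  "integrable halfline (\<lambda>t. (B * indicator {..m} t) powr p)" if "0 < p" "0 \<le> (B::real)"
proof -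
  have "{..m} \<inter> {0<..} = {0<..m}" by auto
  then have "integrable halfline (indicator {..m} :: real \<Rightarrow> real)"
    by (cases "0 \<le> m") (simp_all add: integrable_restrict_space indicator_inter_arith[symmetric] Int_commute)
  then have "integrable halfline (\<lambda>t. B powr p * indicator {..m} t)" by simp
  also have "(\<lambda>t. B powr p * indicator {..m} t) = (\<lambda>t. (B * indicator {..m} t) powr p)"
    by (auto simp: indicator_def)
  finally show ?thesis .
qed

text \<open>
  The mesh is \<open>1 / (N + 1)\<close>, so that no value of \<open>N\<close> is exceptional.
\<close>

definition step_function :: "nat \<Rightarrow> 'a::zero list \<Rightarrow> real \<Rightarrow> 'a" where
  "step_function N ds t =
    (let k = nat \<lfloor>t * real (Suc N)\<rfloor> in if k < length ds then ds ! k else 0)"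

lemma step_function_measurable [measurable]:
  fixes ds :: "'a::{real_normed_field,second_countable_topology} list"
  shows "step_function N ds \<in> borel_measurable halfline"
proof (rule borel_measurable_halfline)
  have "(\<lambda>t::real. \<lfloor>t * real (Suc N)\<rfloor>) \<in> borel \<rightarrow>\<^sub>M count_space UNIV" by measurable
  then have "(\<lambda>t::real. (\<lambda>i. if nat i < length ds then ds ! nat i else 0) \<lfloor>t * real (Suc N)\<rfloor>)
      \<in> borel_measurable borel"
    by (rule measurable_compose) simp
  then show "step_function N ds \<in> borel_measurable borel"
    by (simp add: step_function_def[abs_def] Let_def)
qed

lemma step_function_eq_0:
  assumes "real (length ds) \<le> t"
  shows "step_function N ds t = 0"
proof -
  have "t \<le> t * real (Suc N)" using assms by (simp add: distrib_left)
  then have "int (length ds) \<le> \<lfloor>t * real (Suc N)\<rfloor>" using assms by (simp add: le_floor_iff)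
  then have "\<not> nat \<lfloor>t * real (Suc N)\<rfloor> < length ds" by linarith
  then show ?thesis by (simp only: step_function_def Let_def if_False)
qed

lemma step_function_Lp:
  fixes ds :: "'a::{real_normed_field,second_countable_topology} list"
  assumes "0 < p"
  shows "abs_L0 (step_function N ds) \<in> Lp p"
proof -
  define B where "B = (\<Sum>d\<leftarrow>ds. norm d)"
  have "norm (ds ! k) \<le> B" if "k < length ds" for k
    unfolding B_def using that by (intro member_le_sum_list) auto
  moreover have "0 \<le> B" unfolding B_def by (intro sum_list_nonneg) auto
  ultimately have "norm (step_function N ds t) \<le> B * indicator {..real (length ds)} t" for t
    using step_function_eq_0[of ds t N]
    by (cases "t \<le> length ds") (auto simp: step_function_def Let_def)
  then show ?thesis
    using assms \<open>0 \<le> B\<close>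
    by (intro Lp_dominated_convergence(2)[where u = "\<lambda>_. step_function N ds"
          and G = "\<lambda>t. B * indicator {..real (length ds)} t"] integrable_halfline_cutoff) auto
qed

text \<open>
  Restricting the values of step functions to a countable dense set \<open>D\<close> keeps the family of
  step functions countable.
\<close>

locale step_approximation =
  fixes p :: real and D :: "'a::{real_normed_field,euclidean_space} set"
  assumes p: "1 \<le> p"
    and D_dense: "\<And>U. open U \<Longrightarrow> U \<noteq> {} \<Longrightarrow> \<exists>d\<in>D. d \<in> U"
begin

definition steps :: "'a L0 set" where
  "steps = (\<lambda>(N, ds). abs_L0 (step_function N ds)) ` (UNIV \<times> lists D)"

definition approximable :: "(real \<Rightarrow> 'a) \<Rightarrow> bool" where
  "approximable f \<longleftrightarrow> (\<forall>e>0. \<exists>c\<in>steps. Lp_norm p (abs_L0 f - c) < e)"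

lemma approximable_limit:
  assumes [measurable]: "\<And>n. u n \<in> borel_measurable halfline" "f \<in> borel_measurable halfline"
    and "AE t in halfline. (\<lambda>n. u n t) \<longlonglongrightarrow> f t"
    and "\<And>n t. 0 < t \<Longrightarrow> norm (u n t) \<le> G t"
    and "integrable halfline (\<lambda>t. G t powr p)"
    and u: "\<And>n. approximable (u n)"
  shows "approximable f"
  unfolding approximable_def
proof (intro allI impI)
  interpret normed_space_on scale_L0 "Lp p :: 'a L0 set" "Lp_norm p"
    by (rule normed_space_on_Lp[OF p])
  fix e :: real assume e: "0 < e"
  have p0: "0 < p" using p by simp
  note DC = Lp_dominated_convergence[OF p0 assms(1-5)]
  obtain n where n: "Lp_norm p (abs_L0 f - abs_L0 (u n)) < e / 2"
    using order_tendstoD(2)[OF DC(3), of "e / 2"] e by (auto simp: eventually_sequentially)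
  obtain c where c: "c \<in> steps" "Lp_norm p (abs_L0 (u n) - c) < e / 2"
    using u[of n] e unfolding approximable_def by (meson half_gt_zero)
  have "c \<in> Lp p" using c(1) step_function_Lp[OF p0] by (auto simp: steps_def)
  then have "Lp_norm p (abs_L0 f - c) < e"
    using nrm_diff_triangle[OF DC(2) DC(1), of c n] n c(2) by simp
  then show "\<exists>c\<in>steps. Lp_norm p (abs_L0 f - c) < e" using c(1) by blast
qed

text \<open>
  Sample \<open>g\<close> at the grid points, round the samples to \<open>D\<close> with an error below the mesh, and use
  pointwise convergence together with the bound \<open>B + 1\<close> on \<open>(0, m]\<close>.
\<close>

lemma approximable_continuous:
  fixes g :: "real \<Rightarrow> 'a" and m :: nat
  assumes g: "continuous_on UNIV g" and B: "\<And>t. norm (g t) \<le> B"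
  shows "approximable (\<lambda>t. if t < real m then g t else 0)"
proof -
  define \<delta> where "\<delta> n z = (SOME d. d \<in> D \<and> dist z d < 1 / real (Suc n))" for n z
  have \<delta>: "\<delta> n z \<in> D" "dist z (\<delta> n z) < 1 / real (Suc n)" for n z
  proof -
    have "\<exists>d. d \<in> D \<and> dist z d < 1 / real (Suc n)"
      using D_dense[of "ball z (1 / real (Suc n))"] by auto
    from someI_ex[OF this] show "\<delta> n z \<in> D" "dist z (\<delta> n z) < 1 / real (Suc n)"
      unfolding \<delta>_def by auto
  qed
  define ds where "ds n = map (\<lambda>k. \<delta> n (g (real k / real (Suc n)))) [0..<m * Suc n]" for n
  define s where "s n t = real (nat \<lfloor>t * real (Suc n)\<rfloor>) / real (Suc n)" for n t
  have step: "step_function n (ds n) t = (if t < real m then \<delta> n (g (s n t)) else 0)"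
    if t: "0 < t" for n t
  proof -
    have "nat \<lfloor>t * real (Suc n)\<rfloor> < m * Suc n \<longleftrightarrow> t * real (Suc n) < real (m * Suc n)"
      using t by (simp add: nat_less_iff floor_less_iff)
    also have "\<dots> \<longleftrightarrow> t < real m" by (simp only: of_nat_mult mult_less_cancel_right) simp
    finally show ?thesis by (simp add: step_function_def ds_def s_def Let_def del: of_nat_Suc mult_Suc_right)
  qed
  have s: "(\<lambda>n. s n t) \<longlonglongrightarrow> t" if t: "0 < t" for t
  proof (rule tendsto_sandwich)
    have fl: "real (nat \<lfloor>t * real (Suc n)\<rfloor>) \<le> t * real (Suc n)"
      "t * real (Suc n) - 1 \<le> real (nat \<lfloor>t * real (Suc n)\<rfloor>)" for n
    proof -
      have "0 \<le> t * real (Suc n)" using t by simp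
      then show "real (nat \<lfloor>t * real (Suc n)\<rfloor>) \<le> t * real (Suc n)" by (rule of_nat_floor)
      show "t * real (Suc n) - 1 \<le> real (nat \<lfloor>t * real (Suc n)\<rfloor>)" by linarith
    qed
    show "\<forall>\<^sub>F n in sequentially. s n t \<le> t" "\<forall>\<^sub>F n in sequentially. t - 1 / real (Suc n) \<le> s n t"
      using fl by (simp_all add: s_def divide_simps del: of_nat_Suc)
    show "(\<lambda>n. t - 1 / real (Suc n)) \<longlonglongrightarrow> t"
      using tendsto_diff[OF tendsto_const LIMSEQ_inverse_real_of_nat, of t] by (simp add: inverse_eq_divide)
  qed simp
  have lim: "(\<lambda>n. step_function n (ds n) t) \<longlonglongrightarrow> (if t < real m then g t else 0)" if t: "0 < t" for t
  proof -
    have "(\<lambda>n. g (s n t)) \<longlonglongrightarrow> g t"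
      using g s[OF t] by (intro isCont_tendsto_compose[of _ g]) (auto simp: continuous_on_eq_continuous_at)
    moreover have "(\<lambda>n. \<delta> n (g (s n t)) - g (s n t)) \<longlonglongrightarrow> 0"
    proof (rule Lim_null_comparison)
      show "\<forall>\<^sub>F n in sequentially. norm (\<delta> n (g (s n t)) - g (s n t)) \<le> inverse (real (Suc n))"
        using \<delta>(2) by (auto simp: dist_norm norm_minus_commute inverse_eq_divide less_imp_le simp del: of_nat_Suc)
    qed (rule LIMSEQ_inverse_real_of_nat)
    ultimately have "(\<lambda>n. (\<delta> n (g (s n t)) - g (s n t)) + g (s n t)) \<longlonglongrightarrow> 0 + g t"
      by (intro tendsto_add)
    then show ?thesis by (simp add: step[OF t])
  qed
  have "0 \<le> B" using B norm_ge_zero order_trans by blast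
  show ?thesis
  proof (rule approximable_limit[where u = "\<lambda>n. step_function n (ds n)"
        and G = "\<lambda>t. (B + 1) * indicator {..real m} t"])
    have [measurable]: "g \<in> borel_measurable borel" using g by (rule borel_measurable_continuous_onI)
    have "(\<lambda>t. if t < real m then g t else 0) \<in> borel_measurable borel" by measurable
    then show "(\<lambda>t. if t < real m then g t else 0) \<in> borel_measurable halfline"
      by (rule borel_measurable_halfline)
    show "AE t in halfline. (\<lambda>n. step_function n (ds n) t) \<longlonglongrightarrow> (if t < real m then g t else 0)"
      using lim by (intro AE_I2) simp
    show "norm (step_function n (ds n) t) \<le> (B + 1) * indicator {..real m} t" if "0 < t" for n t
    proof -
      have "norm (\<delta> n z) \<le> norm z + 1" for z
      proof -
        have "dist z (\<delta> n z) < 1 / real (Suc n)" by (rule \<delta>)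
        also have "\<dots> \<le> 1" by simp
        finally show ?thesis using norm_triangle_sub[of "\<delta> n z" z] by (simp add: dist_norm norm_minus_commute)
      qed
      then have "norm (\<delta> n (g (s n t))) \<le> B + 1" using B order_trans add_right_mono by blast
      then show ?thesis using \<open>0 \<le> B\<close> by (simp add: step[OF that])
    qed
    show "integrable halfline (\<lambda>t. ((B + 1) * indicator {..real m} t) powr p)"
      using p \<open>0 \<le> B\<close> by (intro integrable_halfline_cutoff) auto
    show "approximable (step_function n (ds n))" for n
    proof -
      interpret normed_space_on scale_L0 "Lp p :: 'a L0 set" "Lp_norm p"
        by (rule normed_space_on_Lp[OF p])
      have "(n, ds n) \<in> UNIV \<times> lists D" using \<delta>(1) by (auto simp: ds_def)
      then have "abs_L0 (step_function n (ds n)) \<in> steps"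
        unfolding steps_def by (rule image_eqI[rotated]) simp
      then show ?thesis unfolding approximable_def by (metis diff_self nrm_0)
    qed
  qed measurable
qed

text \<open>
  A measurable function is the almost everywhere limit of continuous functions; projecting these
  onto the ball of radius \<open>B\<close> makes dominated convergence applicable.
\<close>

lemma approximable_bounded:
  assumes f[measurable]: "f \<in> borel_measurable halfline" and B: "\<And>t. norm (f t) \<le> B"
    and supp: "\<And>t. real m \<le> t \<Longrightarrow> f t = 0"
  shows "approximable f"
proof -
  have "0 \<le> B" using B norm_ge_zero order_trans by blast
  have "f measurable_on {0<..}" using f by (simp add: measurable_on_iff_borel_measurable)
  then obtain N g where N: "negligible N" and g: "\<And>n. continuous_on UNIV (g n)"
    and gf: "\<And>t. t \<notin> N \<Longrightarrow> (\<lambda>n. g n t) \<longlonglongrightarrow> (if t \<in> {0<..} then f t else 0)"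
    unfolding measurable_on_def by blast
  define P where "P = closest_point (cball (0::'a) B)"
  have ne: "cball (0::'a) B \<noteq> {}" using \<open>0 \<le> B\<close> by simp
  have P: "continuous_on UNIV P"
    unfolding P_def using ne by (intro continuous_on_closest_point) auto
  have PB: "norm (P z) \<le> B" for z
    using closest_point_in_set[OF closed_cball ne, of z] by (simp add: P_def)
  have Pf: "P (f t) = f t" for t using B by (simp add: P_def closest_point_self)
  have Pg: "continuous_on UNIV (\<lambda>t. P (g n t))" for n
    using continuous_on_compose2[OF P g[of n]] by simp
  have "AE t in lebesgue. t \<notin> N" using N by (intro AE_not_in) (simp add: negligible_iff_null_sets)
  then have "AE t in halfline. t \<notin> N" by (auto simp: AE_restrict_space_iff elim: eventually_mono)
  then have lim: "AE t in halfline. (\<lambda>n. if t < real m then P (g n t) else 0) \<longlonglongrightarrow> f t"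
    using AE_space
  proof eventually_elim
    case (elim t)
    then have "(\<lambda>n. g n t) \<longlonglongrightarrow> f t" using gf[of t] by simp
    then have "(\<lambda>n. P (g n t)) \<longlonglongrightarrow> P (f t)"
      using P by (intro isCont_tendsto_compose[of _ P]) (auto simp: continuous_on_eq_continuous_at)
    then show ?case using supp[of t] by (cases "t < real m") (simp_all add: Pf)
  qed
  show ?thesis
  proof (rule approximable_limit[OF _ f lim])
    show "(\<lambda>t. if t < real m then P (g n t) else 0) \<in> borel_measurable halfline" for n
    proof (rule borel_measurable_halfline)
      have [measurable]: "(\<lambda>t. P (g n t)) \<in> borel_measurable borel"
        using Pg by (rule borel_measurable_continuous_onI)
      show "(\<lambda>t. if t < real m then P (g n t) else 0) \<in> borel_measurable borel" by measurable
    qed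
    show "norm (if t < real m then P (g n t) else 0) \<le> B * indicator {..real m} t" for n t
      using PB \<open>0 \<le> B\<close> by simp
    show "integrable halfline (\<lambda>t. (B * indicator {..real m} t) powr p)"
      using p \<open>0 \<le> B\<close> by (intro integrable_halfline_cutoff) auto
    show "approximable (\<lambda>t. if t < real m then P (g n t) else 0)" for n
      using Pg PB by (rule approximable_continuous)
  qed
qed

text \<open>
  Cutting off \<open>f\<close> where its argument or its modulus exceeds \<open>n\<close> reduces the claim to bounded functions
  with bounded support; the cut-off functions are dominated by \<open>|f|\<close>.
\<close>

lemma steps_dense:
  assumes x: "x \<in> Lp p" and e: "0 < e"
  shows "\<exists>c\<in>steps. Lp_norm p (x - c) < e"
proof -
  obtain f where f[measurable]: "f \<in> borel_measurable halfline" and xf: "x = abs_L0 f"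
    by (rule L0_cases)
  let ?u = "\<lambda>n t. if norm (f t) \<le> real n \<and> t < real n then f t else 0"
  have m: "?u n \<in> borel_measurable halfline" for n
  proof -
    have [measurable]: "(\<lambda>t::real. t) \<in> borel_measurable halfline"
      by (rule borel_measurable_halfline) simp
    show ?thesis by measurable
  qed
  have "approximable f"
  proof (rule approximable_limit[OF m f])
    show "AE t in halfline. (\<lambda>n. ?u n t) \<longlonglongrightarrow> f t"
    proof (rule AE_I2)
      fix t
      obtain k :: nat where "max (norm (f t)) t < k" using reals_Archimedean2 by blast
      then have "\<forall>\<^sub>F n in sequentially. ?u n t = f t"
        by (auto simp: eventually_sequentially intro!: exI[of _ k])
      then show "(\<lambda>n. ?u n t) \<longlonglongrightarrow> f t" by (rule tendsto_eventually)
    qed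
    show "norm (?u n t) \<le> norm (f t)" for n t by simp
    show "integrable halfline (\<lambda>t. norm (f t) powr p)"
      using x abs_L0_in_Lp_iff[OF f] by (simp add: xf)
    show "approximable (?u n)" for n
      by (rule approximable_bounded[OF m, where B = "real n" and m = n]) auto
  qed
  then show ?thesis using e by (simp add: approximable_def xf)
qed

end

section \<open>Translations\<close>

lemma AE_lebesgue_translation:
  fixes a :: real
  assumes "AE t in lebesgue. P t"
  shows "AE t in lebesgue. P (t + a)"
proof -
  obtain N where N: "N \<in> null_sets lebesgue" "\<And>t. t \<notin> N \<Longrightarrow> P t"
    using assms by (auto elim!: AE_E3)
  have "AE t in lebesgue. t \<notin> (+) (- a) ` N"
    using negligible_translation[of N "- a"] N(1) by (intro AE_not_in) (simp add: negligible_iff_null_sets)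
  then show ?thesis
  proof eventually_elim
    fix t assume "t \<notin> (+) (- a) ` N"
    then have "t + a \<notin> N" by (auto simp: image_iff)
    then show "P (t + a)" by (rule N(2))
  qed
qed

lemma nn_integral_lebesgue_translation:
  fixes F :: "real \<Rightarrow> ennreal"
  assumes [measurable]: "F \<in> borel_measurable lebesgue"
  shows "(\<integral>\<^sup>+t. F (t + a) \<partial>lebesgue) = (\<integral>\<^sup>+t. F t \<partial>lebesgue)"
proof -
  have [measurable]: "(\<lambda>t. a + 1 * t) \<in> lebesgue \<rightarrow>\<^sub>M lebesgue"
    using lebesgue_affine_measurable[of "\<lambda>_. 1" a] by simp
  have "(\<integral>\<^sup>+t. F t \<partial>lebesgue) = (\<integral>\<^sup>+t. F t \<partial>(distr lebesgue lebesgue (\<lambda>t. a + 1 * t)))"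
    by (subst lebesgue_real_affine[of 1 a]) (simp_all add: density_1)
  also have "\<dots> = (\<integral>\<^sup>+t. F (a + 1 * t) \<partial>lebesgue)" by (rule nn_integral_distr) measurable
  finally show ?thesis by (simp add: add.commute)
qed

lemma nn_integral_halfline_translation:
  assumes F: "F \<in> borel_measurable halfline" and a: "0 \<le> a"
  shows "(\<integral>\<^sup>+t. F (t + a) \<partial>halfline) = (\<integral>\<^sup>+t. F t * indicator {a<..} t \<partial>halfline)"
proof -
  have F0: "(\<lambda>t. F t * indicator {0<..} t) \<in> borel_measurable lebesgue"
    using F by (simp add: borel_measurable_restrict_space_iff_ennreal)
  have eq: "(\<lambda>t. F t * indicator {a<..} t) = (\<lambda>t. F t * indicator {0<..} t * indicator {a<..} t)"
    using a by (auto simp: indicator_def)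
  have [measurable]: "(\<lambda>t. F t * indicator {a<..} t) \<in> borel_measurable lebesgue"
    unfolding eq by (intro borel_measurable_times_ennreal F0 borel_measurable_indicator) simp
  have "(\<integral>\<^sup>+t. F (t + a) \<partial>halfline) = (\<integral>\<^sup>+t. F (t + a) * indicator {a<..} (t + a) \<partial>lebesgue)"
    by (subst nn_integral_restrict_space) (auto intro!: nn_integral_cong simp: indicator_def)
  also have "\<dots> = (\<integral>\<^sup>+t. F t * indicator {a<..} t \<partial>lebesgue)"
    by (rule nn_integral_lebesgue_translation) measurable
  also have "\<dots> = (\<integral>\<^sup>+t. F t * indicator {a<..} t \<partial>halfline)"
    using a by (subst nn_integral_restrict_space) (auto intro!: nn_integral_cong simp: indicator_def)
  finally show ?thesis .
qed

lemma measurable_left_translation: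
  fixes f :: "real \<Rightarrow> 'a::{real_normed_field,second_countable_topology}"
  assumes "f \<in> borel_measurable halfline" "0 \<le> a"
  shows "(\<lambda>t. w * f (t + a)) \<in> borel_measurable halfline"
  using measurable_compose[OF shift_measurable_halfline[OF assms(2)] assms(1)] by simp

lemma measurable_right_translation:
  fixes f :: "real \<Rightarrow> 'a::{real_normed_field,second_countable_topology}"
  assumes f: "f \<in> borel_measurable halfline" and a: "0 \<le> a"
  shows "(\<lambda>t. if a < t then w * f (t - a) else 0) \<in> borel_measurable halfline"
proof -
  have [measurable]: "(\<lambda>t. indicator {0<..} t *\<^sub>R f t) \<in> borel_measurable lebesgue"
    using f by (simp add: borel_measurable_restrict_space_iff)
  have [measurable]: "(\<lambda>t. - a + 1 * t) \<in> lebesgue \<rightarrow>\<^sub>M lebesgue"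
    using lebesgue_affine_measurable[of "\<lambda>_. 1" "- a"] by simp
  have "(\<lambda>t. w * ((\<lambda>t. indicator {0<..} t *\<^sub>R f t) (- a + 1 * t))) \<in> borel_measurable lebesgue"
    by measurable
  also have "(\<lambda>t. w * ((\<lambda>t. indicator {0<..} t *\<^sub>R f t) (- a + 1 * t)))
      = (\<lambda>t. if a < t then w * f (t - a) else 0)"
    by (auto simp: indicator_def)
  finally show ?thesis by (rule measurable_restrict_space1)
qed

text \<open>The values of the representative outside \<open>(0, \<infinity>)\<close> carry no information and are cut off.\<close>

definition right_translation ::
  "'a::{real_normed_field,second_countable_topology} \<Rightarrow> real \<Rightarrow> 'a L0 \<Rightarrow> 'a L0" where
  "right_translation w a x = abs_L0 (\<lambda>t. if a < t then w * rep_L0 x (t - a) else 0)"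

lemma right_translation_abs:
  assumes f: "f \<in> borel_measurable halfline" and a: "0 \<le> a"
  shows "right_translation w a (abs_L0 f) = abs_L0 (\<lambda>t. if a < t then w * f (t - a) else 0)"
proof -
  let ?g = "rep_L0 (abs_L0 f)"
  have eq: "ae_equal ?g f"
    using f by (intro Quotient3_rep_abs[OF Quotient3_L0]) simp
  then have g: "?g \<in> borel_measurable halfline" by (simp add: ae_equal_def)
  have "AE t in lebesgue. 0 < t \<longrightarrow> ?g t = f t"
    using eq by (simp add: ae_equal_def AE_restrict_space_iff)
  from AE_lebesgue_translation[OF this, of "- a"]
  have "AE t in halfline. (if a < t then w * ?g (t - a) else 0) = (if a < t then w * f (t - a) else 0)"
    by (auto simp: AE_restrict_space_iff elim!: eventually_mono)
  then show ?thesis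
    unfolding right_translation_def
    by (subst abs_L0_eq_iff) (intro measurable_right_translation f g a | assumption)+
qed

context
  fixes p a :: real and w :: "'a::{real_normed_field,euclidean_space}"
  assumes p: "1 \<le> p" and a: "0 < a" and w: "1 < norm w"
begin

interpretation normed_space_on scale_L0 "Lp p :: 'a L0 set" "Lp_norm p"
  by (rule normed_space_on_Lp[OF p])

lemma weighted_translation_norm:
  assumes x: "x \<in> Lp p"
  shows "weighted_translation w a x \<in> Lp p"
    and "Lp_norm p (weighted_translation w a x) \<le> norm w * Lp_norm p x"
proof -
  have p0: "0 < p" using p by simp
  obtain f where f[measurable]: "f \<in> borel_measurable halfline" and xf: "x = abs_L0 f"
    by (rule L0_cases)
  have "(\<integral>\<^sup>+t. ennreal (norm (w * f (t + a)) powr p) \<partial>halfline)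
      = (\<integral>\<^sup>+t. ennreal (norm (w * f t) powr p) * indicator {a<..} t \<partial>halfline)"
    using a by (intro nn_integral_halfline_translation[of "\<lambda>t. ennreal (norm (w * f t) powr p)"]) measurable
  also have "\<dots> \<le> (\<integral>\<^sup>+t. ennreal (norm (w * f t) powr p) \<partial>halfline)"
    by (intro nn_integral_mono) (simp add: indicator_def)
  also have "\<dots> = ennreal ((norm w * Lp_norm p x) powr p)"
    using nn_integral_Lp_norm[OF p0, of "\<lambda>t. w * f t"] x carrier_closed(5)[of x w] p0
    by (simp add: xf scale_abs_L0[OF f, symmetric] Lp_norm_scale)
  finally have le: "(\<integral>\<^sup>+t. ennreal (norm (w * f (t + a)) powr p) \<partial>halfline)
      \<le> ennreal ((norm w * Lp_norm p x) powr p)" .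
  show "weighted_translation w a x \<in> Lp p"
    and "Lp_norm p (weighted_translation w a x) \<le> norm w * Lp_norm p x"
    using Lp_norm_leI[OF p0 measurable_left_translation[OF f, of a w] _ le] a
    by (simp_all add: xf weighted_translation_abs[OF f] Lp_norm_nonneg)
qed

lemma right_translation_norm:
  assumes x: "x \<in> Lp p"
  shows "right_translation (inverse w) a x \<in> Lp p"
    and "Lp_norm p (right_translation (inverse w) a x) \<le> Lp_norm p x / norm w"
proof -
  have p0: "0 < p" using p by simp
  obtain f where f[measurable]: "f \<in> borel_measurable halfline" and xf: "x = abs_L0 f"
    by (rule L0_cases)
  let ?g = "\<lambda>t. if a < t then inverse w * f (t - a) else 0"
  have g[measurable]: "?g \<in> borel_measurable halfline"
    using f a by (intro measurable_right_translation) auto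
  have "(\<integral>\<^sup>+t. ennreal (norm (?g t) powr p) \<partial>halfline)
      = (\<integral>\<^sup>+t. ennreal (norm (?g t) powr p) * indicator {a<..} t \<partial>halfline)"
    by (intro nn_integral_cong) (simp add: indicator_def)
  also have "\<dots> = (\<integral>\<^sup>+t. ennreal (norm (?g (t + a)) powr p) \<partial>halfline)"
    using a by (intro nn_integral_halfline_translation[symmetric]) measurable
  also have "\<dots> = (\<integral>\<^sup>+t. ennreal (norm (inverse w * f t) powr p) \<partial>halfline)"
    by (intro nn_integral_cong) simp
  also have "\<dots> = ennreal ((Lp_norm p x / norm w) powr p)"
    using nn_integral_Lp_norm[OF p0, of "\<lambda>t. inverse w * f t"] x carrier_closed(5)[of x "inverse w"] p0
    by (simp add: xf scale_abs_L0[OF f, symmetric] Lp_norm_scale norm_inverse divide_inverse mult.commute)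
  finally have le: "(\<integral>\<^sup>+t. ennreal (norm (?g t) powr p) \<partial>halfline)
      \<le> ennreal ((Lp_norm p x / norm w) powr p)" by simp
  show "right_translation (inverse w) a x \<in> Lp p"
    and "Lp_norm p (right_translation (inverse w) a x) \<le> Lp_norm p x / norm w"
    using Lp_norm_leI[OF p0 g _ le] a
    by (simp_all add: xf right_translation_abs[OF f] Lp_norm_nonneg)
qed

lemma weighted_translation_linear:
  "linear_operator scale_L0 (Lp p) (Lp p) (weighted_translation w a)"
proof (rule linear_operatorI)
  fix x y :: "'a L0" and c :: 'a
  obtain f g where f: "f \<in> borel_measurable halfline" "x = abs_L0 f"
    and g: "g \<in> borel_measurable halfline" "y = abs_L0 g" by (metis L0_cases)
  have [measurable]: "f \<in> borel_measurable halfline" "g \<in> borel_measurable halfline" by fact+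
  show "weighted_translation w a (x + y) = weighted_translation w a x + weighted_translation w a y"
    using a f(1) g(1)
    by (simp add: f(2) g(2) abs_L0_add_diff weighted_translation_abs measurable_left_translation distrib_left)
  show "weighted_translation w a (scale_L0 c x) = scale_L0 c (weighted_translation w a x)"
    using a f(1)
    by (simp add: f(2) scale_abs_L0
        weighted_translation_abs measurable_left_translation mult.left_commute)
qed (rule weighted_translation_norm)

lemma right_translation_linear:
  "linear_operator scale_L0 (Lp p) (Lp p) (right_translation (inverse w) a)"
proof (rule linear_operatorI)
  fix x y :: "'a L0" and c :: 'a
  obtain f g where f: "f \<in> borel_measurable halfline" "x = abs_L0 f"
    and g: "g \<in> borel_measurable halfline" "y = abs_L0 g" by (metis L0_cases)
  have [measurable]: "f \<in> borel_measurable halfline" "g \<in> borel_measurable halfline" by fact+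
  show "right_translation (inverse w) a (x + y)
      = right_translation (inverse w) a x + right_translation (inverse w) a y"
    using a f(1) g(1)
    by (simp add: f(2) g(2) abs_L0_add_diff right_translation_abs measurable_right_translation distrib_left
        if_distrib cong: if_cong)
  show "right_translation (inverse w) a (scale_L0 c x) = scale_L0 c (right_translation (inverse w) a x)"
    using a f(1)
    by (simp add: f(2) scale_abs_L0
        right_translation_abs measurable_right_translation mult.left_commute if_distrib cong: if_cong)
qed (rule right_translation_norm)

lemma weighted_right_translation:
  "weighted_translation w a (right_translation (inverse w) a x) = x"
proof -
  obtain f where f: "f \<in> borel_measurable halfline" "x = abs_L0 f" by (rule L0_cases)
  have g: "(\<lambda>t. if a < t then inverse w * f (t - a) else 0) \<in> borel_measurable halfline"
    using f a by (intro measurable_right_translation) auto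
  have "w \<noteq> 0" using w by auto
  have "weighted_translation w a (right_translation (inverse w) a x)
      = abs_L0 (\<lambda>t. w * (if a < t + a then inverse w * f (t + a - a) else 0))"
    using a by (simp only: f(2) right_translation_abs[OF f(1)] weighted_translation_abs[OF g] less_imp_le)
  also have "\<dots> = x"
    unfolding f(2)
  proof (rule abs_L0_cong)
    show "(\<lambda>t. w * (if a < t + a then inverse w * f (t + a - a) else 0)) \<in> borel_measurable halfline"
      using measurable_left_translation[OF g, of a w] a by simp
  qed (use f \<open>w \<noteq> 0\<close> in auto)
  finally show ?thesis .
qed

lemma weighted_translation_funpow_abs:
  assumes f: "f \<in> borel_measurable halfline"
  shows "(weighted_translation w a ^^ n) (abs_L0 f) = abs_L0 (\<lambda>t. w ^ n * f (t + real n * a))"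
proof (induction n)
  case (Suc n)
  have "weighted_translation w a (abs_L0 (\<lambda>t. w ^ n * f (t + real n * a)))
      = abs_L0 (\<lambda>t. w * (w ^ n * f (t + a + real n * a)))"
    using a by (intro weighted_translation_abs measurable_left_translation f) auto
  then show ?case using Suc by (simp add: algebra_simps)
qed simp

text \<open>
  The weight lives in an arbitrary normed field of finite dimension over the reals, which treats
  real and complex scalars at once. The indicator function of \<open>(0, a]\<close> lies in the kernel: the translation pushes it off the half-line.
\<close>

theorem weighted_translation_generalized_backward_shift:
  "\<exists>C x0. generalized_backward_shift scale_L0 (Lp p) (Lp_norm p) (weighted_translation w a)
    (right_translation (inverse w) a) (norm w) C x0"
proof -
  interpret banach_space_on scale_L0 "Lp p :: 'a L0 set" "Lp_norm p"
    by (rule banach_space_on_Lp[OF p])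
  have p0: "0 < p" using p by simp
  obtain D :: "'a set" where D: "countable D" "\<And>U. open U \<Longrightarrow> U \<noteq> {} \<Longrightarrow> \<exists>d\<in>D. d \<in> U"
    using countable_dense_exists[where ?'a = 'a] by blast
  interpret step_approximation p D by unfold_locales (use p D in auto)
  define k :: "real \<Rightarrow> 'a" where "k t = (if t \<le> a then 1 else 0)" for t
  have k: "k \<in> borel_measurable halfline"
    unfolding k_def by (intro borel_measurable_halfline) measurable
  have "generalized_backward_shift scale_L0 (Lp p) (Lp_norm p) (weighted_translation w a)
    (right_translation (inverse w) a) (norm w) steps (abs_L0 k)"
  proof unfold_locales
    show "countable steps" unfolding steps_def using D(1) by (intro countable_image) auto
    show "steps \<subseteq> Lp p" using step_function_Lp[OF p0] by (auto simp: steps_def)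
    show "\<exists>n. (weighted_translation w a ^^ n) c = 0" if "c \<in> steps" for c
    proof -
      obtain N ds where c: "c = abs_L0 (step_function N ds)" using \<open>c \<in> steps\<close> by (auto simp: steps_def)
      obtain n :: nat where n: "real (length ds) \<le> real n * a"
        using real_arch_simple[of "real (length ds) / a"] a by (auto simp: field_simps)
      have "(weighted_translation w a ^^ n) c = abs_L0 (\<lambda>t. w ^ n * step_function N ds (t + real n * a))"
        unfolding c by (intro weighted_translation_funpow_abs) measurable
      also have "\<dots> = abs_L0 (\<lambda>_. 0)"
        using a n by (intro abs_L0_cong measurable_left_translation)
          (auto simp: step_function_eq_0)
      finally show ?thesis by (auto simp: zero_L0_def)
    qed
    show "abs_L0 k \<in> Lp p"
      using p0 k
      by (intro Lp_dominated_convergence(2)[where u = "\<lambda>_. k" and G = "\<lambda>t. 1 * indicator {..a} t"]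
          integrable_halfline_cutoff) (auto simp: k_def)
    have "weighted_translation w a (abs_L0 k) = abs_L0 (\<lambda>t. w * k (t + a))"
      using a by (intro weighted_translation_abs k) auto
    also have "\<dots> = abs_L0 (\<lambda>_. 0)"
      using a by (intro abs_L0_cong measurable_left_translation k) (auto simp: k_def)
    finally show "weighted_translation w a (abs_L0 k) = 0" by (simp add: zero_L0_def)
    show "abs_L0 k \<noteq> 0"
    proof
      assume "abs_L0 k = 0"
      then have "AE t in halfline. k t = 0" using abs_L0_eq_iff[OF k, of "\<lambda>_. 0"] by (simp add: zero_L0_def)
      then have "AE t in lebesgue. t \<notin> {0<..a}"
        by (auto simp: AE_restrict_space_iff k_def elim!: eventually_mono)
      then have "{0<..a} \<in> null_sets lebesgue" by (subst AE_iff_null_sets) auto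
      then show False using a by (simp add: null_sets_def)
    qed
  qed (use w in \<open>simp_all add: weighted_translation_linear right_translation_linear weighted_translation_norm
      right_translation_norm weighted_right_translation steps_dense\<close>)
  then show ?thesis by blast
qed

end

section \<open>Chaos and spectrum of the weighted translation\<close>

theorem theorem3p1:
  fixes p a :: real
  assumes "1 \<le> p" and "0 < a"
  shows
    "(\<forall>w::real. 1 < norm w \<longrightarrow>
        bounded_linear_operator scale_L0 (Lp p) (Lp_norm p) (weighted_translation w a) \<and>
        chaotic (Lp p) (Lp_norm p) (Lp p) (weighted_translation w a)) \<and>
     (\<forall>w::complex. 1 < norm w \<longrightarrow>
        bounded_linear_operator scale_L0 (Lp p) (Lp_norm p) (weighted_translation w a) \<and>
        chaotic (Lp p) (Lp_norm p) (Lp p) (weighted_translation w a) \<and>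
        spectrum scale_L0 (Lp p) (Lp_norm p) (Lp p) (weighted_translation w a)
          = {l. norm l \<le> norm w} \<and>
        point_spectrum scale_L0 (Lp p) (weighted_translation w a) = {l. norm l < norm w} \<and>
        continuous_spectrum scale_L0 (Lp p) (Lp_norm p) (Lp p) (weighted_translation w a)
          = {l. norm l = norm w})"
proof (intro conjI allI impI)
  fix w :: real assume "1 < norm w"
  then obtain C x0 where "generalized_backward_shift scale_L0 (Lp p) (Lp_norm p)
      (weighted_translation w a) (right_translation (inverse w) a) (norm w) C x0"
    using weighted_translation_generalized_backward_shift assms by blast
  then interpret generalized_backward_shift scale_L0 "Lp p" "Lp_norm p" "weighted_translation w a"
    "right_translation (inverse w) a" "norm w" C x0 .
  show "bounded_linear_operator scale_L0 (Lp p) (Lp_norm p) (weighted_translation w a)"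
    by (rule bounded_linear)
  show "chaotic (Lp p) (Lp_norm p) (Lp p) (weighted_translation w a)" by (rule chaotic_T)
next
  fix w :: complex assume "1 < norm w"
  then obtain C x0 where "generalized_backward_shift scale_L0 (Lp p) (Lp_norm p)
      (weighted_translation w a) (right_translation (inverse w) a) (norm w) C x0"
    using weighted_translation_generalized_backward_shift assms by blast
  then interpret complex_generalized_backward_shift scale_L0 "Lp p" "Lp_norm p" "weighted_translation w a"
    "right_translation (inverse w) a" "norm w" C x0
    by (rule complex_generalized_backward_shift.intro)
  show "bounded_linear_operator scale_L0 (Lp p) (Lp_norm p) (weighted_translation w a)"
    by (rule bounded_linear)
  show "chaotic (Lp p) (Lp_norm p) (Lp p) (weighted_translation w a)" by (rule chaotic_T)
  show "spectrum scale_L0 (Lp p) (Lp_norm p) (Lp p) (weighted_translation w a)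
      = {l. norm l \<le> norm w}" by (rule spectrum_eq)
  show "point_spectrum scale_L0 (Lp p) (weighted_translation w a) = {l. norm l < norm w}"
    by (rule point_spectrum_eq)
  show "continuous_spectrum scale_L0 (Lp p) (Lp_norm p) (Lp p) (weighted_translation w a)
      = {l. norm l = norm w}" by (rule continuous_spectrum_eq)
qed

end
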